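(* Let $N\ge 1$ be an integer, let $\lambda,\beta,\rho_o,P_u,\alpha_L,\alpha_N,\theta>0$ and $\sigma^2\ge 0$. In the single-tier mmWave uplink model with truncated channel inversion power control with cutoff threshold $\rho_o$ described in the context, the SINR outage probability $\mathcal O_s$ for target SINR $\theta$ is $$\mathcal O_s=1-\sum_{n=1}^{N}(-1)^{n+1}\binom{N}{n}\exp\left(-\frac{\eta n\theta\sigma^2}{\rho_o\mathcal G}-Q_n-V_n\right),$$ where $$Q_n=2\pi\lambda\sum_{v=1}^4 b_v q_v^{\frac{2}{\alpha_L}}\int_{\mathcal A}^\infty\int_0^{P_u}\mathcal F\left(N,\frac{y^{-\alpha_L}}{N}\right)\exp\left(-\beta(q_vp)^{\frac1{\alpha_L}}y\right)y\,p^{\frac{2}{\alpha_L}}f_P(p)\,\mathrm dp\,\mathrm dy,$$ $$V_n=2\pi\lambda\sum_{v=1}^4 b_v q_v^{\frac{2}{\alpha_N}}\int_{\mathcal B}^\infty\int_0^{P_u}\mathcal F\left(N,\frac{y^{-\alpha_N}}{N}\right)\left(1-\exp\left(-\beta(q_vp)^{\frac1{\alpha_N}}y\right)\right)y\,p^{\frac{2}{\alpha_N}}f_P(p)\,\mathrm dp\,\mathrm dy,$$ with $\eta=N(N!)^{-1/N}$, $\mathcal G=G_u^{\max}G_b^{\max}$, $\mathcal A=\left(\frac{\eta n\theta a_v}{\mathcal G}\right)^{-1/\alpha_L}$, $\mathcal B=\left(\frac{\eta n\theta a_v}{\mathcal G}\right)^{-1/\alpha_N}$, $q_v=\frac{\eta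 n\theta a_v}{\rho_o\mathcal G}$ and $\mathcal F(N,y)=1-\frac{1}{(1+y)^N}$.
   Context: Antenna gains. $G_u^{\max},G_u^{\min},G_b^{\max},G_b^{\min}>0$ are main/side lobe gains (linear scale) of users and base stations (BSs), and $\zeta_t,\zeta_r\in(0,2\pi]$ their beamwidths. The gain of an interfering link is a discrete random variable equal to $a_v$ with probability $b_v$, $v=1,\dots,4$, where $a_1=G_b^{\max}G_u^{\max}$, $a_2=G_b^{\max}G_u^{\min}$, $a_3=G_b^{\min}G_u^{\max}$, $a_4=G_b^{\min}G_u^{\min}$ and $b_1=\frac{\zeta_r\zeta_t}{4\pi^2}$, $b_2=\frac{\zeta_r}{2\pi}(1-\frac{\zeta_t}{2\pi})$, $b_3=(1-\frac{\zeta_r}{2\pi})\frac{\zeta_t}{2\pi}$, $b_4=(1-\frac{\zeta_r}{2\pi})(1-\frac{\zeta_t}{2\pi})$. Transmit powers. $f_P$ is the density on $[0,P_u]$ given by $f_P(p)=\frac{\lambda(p)e^{-\Lambda(p)}}{\int_0^{P_u}\lambda(y)e^{-\Lambda(y)}\mathrm dy}$, where $\lambda(p)=\frac{2\pi\lambda}{\alpha_L\rho_o^{2/\alpha_L}}p^{\frac{2}{\alpha_L}-1}e^{-\beta(p/\rho_o)^{1/\alpha_L}}+\frac{2\pi\lambda}{\alpha_N\rho_o^{2/\alpha_N}}p^{\frac{2}{\alpha_N}-1}\left(1-e^{-\beta(p/\rho_o)^{1/\alpha_N}}\right)$ and $\Lambda(p)=\int_0^p\lambda(t)\,\mathrm dt$.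 (The symbol $\lambda$ alone denotes the BS density.) Interference. The reference BS is at the origin. Interfering users form a homogeneous Poisson point process of density $\lambda$ in $\mathbb R^2$. Each interferer at $u_z$ carries marks, independent across interferers, mutually independent and independent of the locations: a transmit power $P_z$ with density $f_P$; a gain $G_z$ with $\mathbb P(G_z=a_v)=b_v$ for $v=1,\dots,4$; a fading power $|g_z|^2$ that is Gamma distributed with shape $N$ and mean $1$ (Nakagami fading). Independently for each interferer, its link to the origin is line-of-sight (LOS) with probability $e^{-\beta\|u_z\|}$ and otherwise NLOS. $\Phi_L,\Phi_N$ denote the sets of LOS and NLOS interferers, and $$I_s=\sum_{u_z\in\Phi_s}\mathbf 1\left(P_z\|u_z\|^{-\alpha_s}<\rho_o\right)P_zG_z|g_z|^2\|u_z\|^{-\alpha_s},\qquad s\in\{L,N\}$$ (the indicator expresses that the average interference, before gains, received from any single interferer is less than $\rho_o$). SINR outage. The SINR is $\frac{\rho_o|g_o|^2\mathcal G}{\sigma^2+I_L+I_N}$, with $|g_o|^2$ Gamma distributed with shape $N$ and mean $1$, independent of $I_L,I_N$; the outage event is $\{\mathrm{SINR}\le\theta\}$. Its probability is evaluated under the approximation that replaces the distribution function $\mathbb P(|g_o|^2<\gamma)$ by $\left(1-e^{-\eta\gamma}\right)^N$ with $\eta=N(N!)^{-1/N}$; that is, $$\mathcal O_s:=\mathbb E\left[\left(1-e^{-\frac{\eta\theta(\sigma^2+I_L+I_N)}{\rho_o\mathcal G}}\right)^N\right].$$ The integrals $Q_n,V_n$ take values in $[0,\infty]$, with $e^{-\infty}=0$.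 *)

theory Defs
  imports "HOL-Probability.Probability"
begin

record uplink =
  bs_density :: real   (* \<lambda>: density of the BSs and of the interfering users *)
  blockage :: real     (* \<beta> *)
  cutoff :: real       (* \<rho>_o *)
  max_power :: real    (* P_u *)
  alpha_L :: real
  alpha_N :: real
  shape :: nat         (* N: shape of the Gamma distributed fading powers *)
  noise :: real        (* \<sigma>^2 *)
  Gu_max :: real
  Gu_min :: real
  Gb_max :: real
  Gb_min :: real
  zeta_t :: real
  zeta_r :: real

(* Only the indices v = 1, 2, 3, 4 are meant. *)

definition gain_val :: "uplink \<Rightarrow> nat \<Rightarrow> real" where
  "gain_val S v =
     (if v = 1 then Gb_max S * Gu_max S
      else if v = 2 then Gb_max S * Gu_min S
      else if v = 3 then Gb_min S * Gu_max S
      else Gb_min S * Gu_min S)"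

definition gain_prob :: "uplink \<Rightarrow> nat \<Rightarrow> real" where
  "gain_prob S v =
     (if v = 1 then zeta_r S * zeta_t S / (4 * pi\<^sup>2)
      else if v = 2 then zeta_r S / (2 * pi) * (1 - zeta_t S / (2 * pi))
      else if v = 3 then (1 - zeta_r S / (2 * pi)) * (zeta_t S / (2 * pi))
      else (1 - zeta_r S / (2 * pi)) * (1 - zeta_t S / (2 * pi)))"

definition main_gain :: "uplink \<Rightarrow> real" where
  "main_gain S = Gu_max S * Gb_max S"

definition power_rate :: "uplink \<Rightarrow> real \<Rightarrow> real" where
  "power_rate S p =
     2 * pi * bs_density S / (alpha_L S * cutoff S powr (2 / alpha_L S))
       * p powr (2 / alpha_L S - 1)
       * exp (- blockage S * (p / cutoff S) powr (1 / alpha_L S))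
   + 2 * pi * bs_density S / (alpha_N S * cutoff S powr (2 / alpha_N S))
       * p powr (2 / alpha_N S - 1)
       * (1 - exp (- blockage S * (p / cutoff S) powr (1 / alpha_N S)))"

definition power_cumrate :: "uplink \<Rightarrow> real \<Rightarrow> real" where
  "power_cumrate S p = (LBINT t:{0..p}. power_rate S t)"

definition power_density :: "uplink \<Rightarrow> real \<Rightarrow> real" where
  "power_density S p =
     (if p \<in> {0..max_power S}
      then power_rate S p * exp (- power_cumrate S p)
             / (LBINT y:{0..max_power S}. power_rate S y * exp (- power_cumrate S y))
      else 0)"

(* The points of the process are enumerated as X 0, X 1, ... (with intensity c > 0 on the whole
   space there are almost surely infinitely many). The counts are almost surely finite because
   the Poisson masses add up to 1; the explicit finiteness is needed since card is 0 on infinite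
   sets. The masses are spelled out because poisson_pmf is only specified for positive rates,
   whereas B may be a null set. *)

definition homogeneous_ppp ::
  "'w measure \<Rightarrow> real \<Rightarrow> (nat \<Rightarrow> 'w \<Rightarrow> 'a::euclidean_space) \<Rightarrow> bool" where
  "homogeneous_ppp M c X \<longleftrightarrow>
     (\<forall>z. X z \<in> borel_measurable M) \<and>
     (\<forall>B\<in>sets borel. bounded B \<longrightarrow>
        (\<forall>k. measure M {\<omega>\<in>space M. finite {z. X z \<omega> \<in> B} \<and> card {z. X z \<omega> \<in> B} = k}
             = (c * measure lborel B) ^ k / fact k * exp (- (c * measure lborel B)))) \<and>
     (\<forall>(I :: nat set) B. finite I \<longrightarrow> disjoint_family_on B I \<longrightarrow>
        (\<forall>i\<in>I. B i \<in> sets borel \<and> bounded (B i)) \<longrightarrow>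
        prob_space.indep_vars M (\<lambda>_. count_space UNIV) (\<lambda>i \<omega>. card {z. X z \<omega> \<in> B i}) I)"

definition locations :: "(nat \<Rightarrow> 'w \<Rightarrow> real^2) \<Rightarrow> 'w \<Rightarrow> nat \<Rightarrow> real^2" where
  "locations u \<omega> = (\<lambda>z. u z \<omega>)"

(* All marks except the LOS indicator as one family, indexed by the disjoint sum of three
   copies of nat. *)

definition mark :: "(nat \<Rightarrow> 'w \<Rightarrow> real) \<Rightarrow> (nat \<Rightarrow> 'w \<Rightarrow> real) \<Rightarrow> (nat \<Rightarrow> 'w \<Rightarrow> real)
    \<Rightarrow> nat + nat + nat \<Rightarrow> 'w \<Rightarrow> real" where
  "mark P G g = case_sum P (case_sum G g)"

definition marks :: "(nat \<Rightarrow> 'w \<Rightarrow> real) \<Rightarrow> (nat \<Rightarrow> 'w \<Rightarrow> real) \<Rightarrow> (nat \<Rightarrow> 'w \<Rightarrow> real)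
    \<Rightarrow> 'w \<Rightarrow> nat + nat + nat \<Rightarrow> real" where
  "marks P G g \<omega> = (\<lambda>i. mark P G g i \<omega>)"

definition location_mark_algebra ::
  "'w measure \<Rightarrow> (nat \<Rightarrow> 'w \<Rightarrow> real^2) \<Rightarrow> (nat \<Rightarrow> 'w \<Rightarrow> real) \<Rightarrow> (nat \<Rightarrow> 'w \<Rightarrow> real)
     \<Rightarrow> (nat \<Rightarrow> 'w \<Rightarrow> real) \<Rightarrow> 'w measure" where
  "location_mark_algebra M u P G g =
     vimage_algebra (space M) (\<lambda>\<omega>. (locations u \<omega>, marks P G g \<omega>))
       ((\<Pi>\<^sub>M z\<in>UNIV. borel) \<Otimes>\<^sub>M (\<Pi>\<^sub>M i\<in>UNIV. borel))"

(* Interferer z is located at u z, with transmit power P z, gain G z and fading power g z;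
   los z tells whether its link is LOS.
   locations_marks_indep: independence of the generated sigma-algebras, since indep_var needs
   both variables to have the same type.
   gain_law: the gain takes the value a_v with probability b_v; summing over the v with the
   same a_v covers the case that some of the four values coincide.
   fading_law: erlang_density (N - 1) N is the Gamma density with shape N and mean 1.
   los_law: given all locations and all other marks, the LOS indicators are independent, with
   success probability exp (- \<beta> * norm (u z)). *)

locale interference_field = prob_space M for M :: "'w measure" +
  fixes S :: uplink
    and u :: "nat \<Rightarrow> 'w \<Rightarrow> real^2"
    and P G g :: "nat \<Rightarrow> 'w \<Rightarrow> real"
    and los :: "nat \<Rightarrow> 'w \<Rightarrow> bool"
  assumes ppp: "homogeneous_ppp M (bs_density S) u"
    and marks_indep: "indep_vars (\<lambda>_. borel) (mark P G g) UNIV"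
    and locations_marks_indep:
      "indep_set
         (sets (vimage_algebra (space M) (locations u) (\<Pi>\<^sub>M z\<in>UNIV. borel)))
         (sets (vimage_algebra (space M) (marks P G g) (\<Pi>\<^sub>M i\<in>UNIV. borel)))"
    and power_law: "\<And>z. distributed M lborel (P z) (\<lambda>p. ennreal (power_density S p))"
    and gain_law: "\<And>z x. prob {\<omega>\<in>space M. G z \<omega> = x} =
        (\<Sum>v | v \<in> {1..4} \<and> gain_val S v = x. gain_prob S v)"
    and fading_law:
      "\<And>z. distributed M lborel (g z)
         (\<lambda>x. ennreal (erlang_density (shape S - 1) (real (shape S)) x))"
    and los_measurable: "\<And>z. los z \<in> measurable M (count_space UNIV)"
    and los_law: "\<And>J. finite J \<Longrightarrow>
        AE \<omega> in M.
          real_cond_exp M (location_mark_algebra M u P G g)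
            (indicator {\<omega>\<in>space M. \<forall>z\<in>J. los z \<omega>}) \<omega>
          = (\<Prod>z\<in>J. exp (- blockage S * norm (u z \<omega>)))"

(* The interference from the interferers z with A z; it may be infinite. *)

definition interference ::
  "uplink \<Rightarrow> real \<Rightarrow> (nat \<Rightarrow> 'w \<Rightarrow> real^2) \<Rightarrow> (nat \<Rightarrow> 'w \<Rightarrow> real) \<Rightarrow> (nat \<Rightarrow> 'w \<Rightarrow> real)
     \<Rightarrow> (nat \<Rightarrow> 'w \<Rightarrow> real) \<Rightarrow> (nat \<Rightarrow> 'w \<Rightarrow> bool) \<Rightarrow> 'w \<Rightarrow> ennreal" where
  "interference S \<alpha> u P G g A \<omega> =
     (\<Sum>z. if A z \<omega> \<and> P z \<omega> * norm (u z \<omega>) powr (- \<alpha>) < cutoff S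
           then ennreal (P z \<omega> * G z \<omega> * g z \<omega> * norm (u z \<omega>) powr (- \<alpha>))
           else 0)"

definition exp_neg :: "ennreal \<Rightarrow> real" where
  "exp_neg x = (if x = \<top> then 0 else exp (- enn2real x))"

definition eta :: "nat \<Rightarrow> real" where
  "eta N = real N * fact N powr (- 1 / real N)"

(* E[F(\<theta> (\<sigma>^2 + I_L + I_N) / (\<rho>_o \<G>))] with F(x) = (1 - exp (- \<eta> x)) ^ N in place of the
   distribution function of the fading power of the reference link. *)

definition sinr_outage ::
  "'w measure \<Rightarrow> uplink \<Rightarrow> (nat \<Rightarrow> 'w \<Rightarrow> real^2) \<Rightarrow> (nat \<Rightarrow> 'w \<Rightarrow> real) \<Rightarrow> (nat \<Rightarrow> 'w \<Rightarrow> real)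
     \<Rightarrow> (nat \<Rightarrow> 'w \<Rightarrow> real) \<Rightarrow> (nat \<Rightarrow> 'w \<Rightarrow> bool) \<Rightarrow> real \<Rightarrow> real" where
  "sinr_outage M S u P G g los \<theta> =
     (\<integral>\<omega>. (1 - exp_neg (ennreal (eta (shape S) * \<theta> / (cutoff S * main_gain S)) *
              (ennreal (noise S)
               + interference S (alpha_L S) u P G g los \<omega>
               + interference S (alpha_N S) u P G g (\<lambda>z \<omega>. \<not> los z \<omega>) \<omega>))) ^ shape S \<partial>M)"

definition fading_F :: "nat \<Rightarrow> real \<Rightarrow> real" where
  "fading_F N y = 1 - 1 / (1 + y) ^ N"

definition q_val :: "uplink \<Rightarrow> real \<Rightarrow> nat \<Rightarrow> nat \<Rightarrow> real" where
  "q_val S \<theta> n v = eta (shape S) * real n * \<theta> * gain_val S v / (cutoff S * main_gain S)"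

(* \<A> and \<B>, for \<alpha> = \<alpha>_L and \<alpha> = \<alpha>_N *)

definition lower_limit :: "uplink \<Rightarrow> real \<Rightarrow> real \<Rightarrow> nat \<Rightarrow> nat \<Rightarrow> real" where
  "lower_limit S \<alpha> \<theta> n v =
     (eta (shape S) * real n * \<theta> * gain_val S v / main_gain S) powr (- 1 / \<alpha>)"

definition Q_term :: "uplink \<Rightarrow> real \<Rightarrow> nat \<Rightarrow> ennreal" where
  "Q_term S \<theta> n =
     ennreal (2 * pi * bs_density S) *
     (\<Sum>v = 1..4. ennreal (gain_prob S v * q_val S \<theta> n v powr (2 / alpha_L S)) *
        (\<integral>\<^sup>+y\<in>{lower_limit S (alpha_L S) \<theta> n v..}. (\<integral>\<^sup>+p\<in>{0..max_power S}.
           ennreal (fading_F (shape S) (y powr (- alpha_L S) / real (shape S))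
             * exp (- blockage S * (q_val S \<theta> n v * p) powr (1 / alpha_L S) * y)
             * y * p powr (2 / alpha_L S) * power_density S p) \<partial>lborel) \<partial>lborel))"

definition V_term :: "uplink \<Rightarrow> real \<Rightarrow> nat \<Rightarrow> ennreal" where
  "V_term S \<theta> n =
     ennreal (2 * pi * bs_density S) *
     (\<Sum>v = 1..4. ennreal (gain_prob S v * q_val S \<theta> n v powr (2 / alpha_N S)) *
        (\<integral>\<^sup>+y\<in>{lower_limit S (alpha_N S) \<theta> n v..}. (\<integral>\<^sup>+p\<in>{0..max_power S}.
           ennreal (fading_F (shape S) (y powr (- alpha_N S) / real (shape S))
             * (1 - exp (- blockage S * (q_val S \<theta> n v * p) powr (1 / alpha_N S) * y))
             * y * p powr (2 / alpha_N S) * power_density S p) \<partial>lborel) \<partial>lborel))"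

end

(* Expanding the N-th power binomially reduces the outage to the Laplace transforms
   E exp (- s (I_L + I_N)) at s = n \<eta> \<theta> / (\<rho>_o \<G>), 1 \<le> n \<le> N. Such a transform is the expectation of a
   product over the interferers. Averaging the factors first over the LOS indicators given everything
   else, and then over the marks given the locations, replaces each of them by a function \<phi> of the
   location. The Poisson process turns the product of the \<phi> (u z) into
   exp (- \<lambda> \<integral> (1 - \<phi>)): for finitely many values on bounded sets this is the generating function of
   independent Poisson counts, and the general case follows by monotone approximation. Polar
   coordinates and the substitution r = (q_v p)^(1/\<alpha>) y bring the integral into the form Q_n + V_n. *)

theory Submission
  imports Defs
begin

section \<open>Exponentials of extended nonnegative reals\<close>

text \<open>Nothing forces the interference to be finite: for \<open>alpha_N S\<close> at most 2 the
  integrand of V_n decays too slowly, V_n is infinite and the Laplace transform vanishes. All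
  exponents therefore stay in \<open>ennreal\<close>, where \<open>exp_neg\<close> is continuous and
  sends infinity to 0. For the same reason the losses 1 - \<phi> are carried as nonnegative
  integrals: Tonelli and monotone convergence apply to them with no integrability to check.

  Neither averaging step acts on infinitely many interferers at once: the LOS law describes finite
  sets of indices, and independence turns the mean of a finite product into a product of means. Both
  are applied to the first n interferers of the enumeration. All factors lie in [0,1], so dominated
  convergence with bound 1 leads to the full product. The Laplace functional is then used for -ln
  \<phi>, set to infinity where \<phi> is 0, and hence has to hold for functions with infinite
  values.\<close>

lemma exp_neg_ennreal: "0 \<le> x \<Longrightarrow> exp_neg (ennreal x) = exp (- x)"
  by (simp add: exp_neg_def)

lemma exp_neg_0 [simp]: "exp_neg 0 = 1"
  by (simp add: exp_neg_def)

lemma exp_neg_top [simp]: "exp_neg \<top> = 0"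
  by (simp add: exp_neg_def)

lemma exp_neg_nonneg [simp]: "0 \<le> exp_neg x"
  by (simp add: exp_neg_def)

lemma exp_neg_le_1 [simp]: "exp_neg x \<le> 1"
  by (simp add: exp_neg_def)

lemma exp_neg_add: "exp_neg (x + y) = exp_neg x * exp_neg y"
proof (cases "x = \<top> \<or> y = \<top>")
  case False
  then show ?thesis
    by (simp add: exp_neg_def enn2real_plus less_top exp_add[symmetric])
qed auto

lemma exp_neg_sum: "exp_neg (sum f I) = (\<Prod>i\<in>I. exp_neg (f i))"
  by (induction I rule: infinite_finite_induct) (auto simp: exp_neg_add)

lemma exp_neg_of_nat_mult: "exp_neg (ennreal (real n) * x) = exp_neg x ^ n"
proof -
  have "ennreal (real n) * x = (\<Sum>i<n. x)"
    by (simp add: ennreal_of_nat_eq_real_of_nat)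
  then show ?thesis
    by (simp only: exp_neg_sum prod_constant card_lessThan)
qed

lemma exp_neg_antimono: "x \<le> y \<Longrightarrow> exp_neg y \<le> exp_neg x"
  by (cases "y = \<top>") (auto simp: exp_neg_def top_unique intro!: enn2real_mono simp: less_top)

lemma tendsto_exp_neg:
  assumes "(f \<longlongrightarrow> x) F"
  shows "((\<lambda>n. exp_neg (f n)) \<longlongrightarrow> exp_neg x) F"
proof (cases "x = \<top>")
  case False
  have "eventually (\<lambda>n. f n < \<top>) F"
    using assms False by (simp add: order_tendstoD(2) less_top)
  then have "eventually (\<lambda>n. exp (- enn2real (f n)) = exp_neg (f n)) F"
    by eventually_elim (simp add: exp_neg_def)
  moreover have "((\<lambda>n. exp (- enn2real (f n))) \<longlongrightarrow> exp (- enn2real x)) F"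
    using assms False by (intro tendsto_intros tendsto_enn2real) (auto simp: less_top)
  ultimately show ?thesis
    using False by (auto simp: exp_neg_def[of x] intro: Lim_transform_eventually)
next
  case True
  show ?thesis
  proof (rule tendstoI)
    fix e :: real assume "e > 0"
    \<comment> \<open>Any bound above -ln e works, since exp (-(1 - ln e)) < e; the maximum keeps it
      nonnegative, as \<open>exp_neg_ennreal\<close> requires.\<close>
    have "eventually (\<lambda>n. ennreal (max 0 (1 - ln e)) < f n) F"
      using assms True by (intro order_tendstoD(1)) auto
    then show "eventually (\<lambda>n. dist (exp_neg (f n)) (exp_neg x) < e) F"
    proof eventually_elim
      case (elim n)
      have "exp_neg (f n) \<le> exp (- max 0 (1 - ln e))"
        using exp_neg_antimono[OF less_imp_le[OF elim]] exp_neg_ennreal[of "max 0 (1 - ln e)"]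
        by (simp del: ennreal_max_0 ennreal_max_0')
      also have "\<dots> < exp (ln e)"
        by (subst exp_less_cancel_iff) auto
      finally show ?case
        using True \<open>e > 0\<close> by (simp add: dist_real_def)
    qed
  qed
qed

lemma borel_measurable_exp_neg [measurable]: "exp_neg \<in> borel_measurable borel"
  by (intro borel_measurable_continuous_onI)
     (auto simp: continuous_on_def intro: tendsto_exp_neg)

text \<open>Every function with values in [0,1], zeros included, is thereby \<open>exp_neg\<close>
  of an \<open>ennreal\<close>-valued function; this feeds products of such factors into the Laplace
  functional.\<close>

lemma exp_neg_minus_ln:
  assumes "0 \<le> r" "r \<le> 1"
  shows "exp_neg (if r = 0 then \<top> else ennreal (- ln r)) = r"
  using assms by (auto simp: exp_neg_ennreal)

section \<open>The Laplace functional of a homogeneous Poisson point process\<close>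

lemma measurable_ppp_finite:
  fixes X :: "nat \<Rightarrow> 'w \<Rightarrow> 'a::euclidean_space"
  assumes [measurable]: "\<And>z. X z \<in> borel_measurable M" and [measurable]: "B \<in> sets borel"
  shows "{\<omega>\<in>space M. finite {z. X z \<omega> \<in> B}} \<in> sets M"
proof -
  \<comment> \<open>For a set of naturals finiteness is boundedness, which leaves only countable
    quantifiers.\<close>
  have "{\<omega>\<in>space M. finite {z. X z \<omega> \<in> B}} = {\<omega>\<in>space M. \<exists>m. \<forall>z. X z \<omega> \<in> B \<longrightarrow> z < m}"
    by (auto simp: finite_nat_set_iff_bounded)
  also have "\<dots> \<in> sets M"
    by measurable
  finally show ?thesis .
qed

context
  fixes M :: "'w measure" and c :: real and X :: "nat \<Rightarrow> 'w \<Rightarrow> 'a::euclidean_space"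
  assumes M: "prob_space M" and c: "c > 0" and ppp: "homogeneous_ppp M c X"
begin

interpretation prob_space M by (rule M)

lemma ppp_points_measurable: "X z \<in> borel_measurable M"
  using ppp by (auto simp: homogeneous_ppp_def)

lemma ppp_indep:
  assumes "finite I" "disjoint_family_on B I" "\<And>i. i \<in> I \<Longrightarrow> B i \<in> sets borel \<and> bounded (B i)"
  shows "indep_vars (\<lambda>_. count_space UNIV) (\<lambda>i \<omega>. card {z. X z \<omega> \<in> B i}) (I :: nat set)"
  using ppp assms unfolding homogeneous_ppp_def by blast

text \<open>Measurability of the counts is part of \<open>indep_vars\<close>; a family with a single
  member brings it out.\<close>

lemma ppp_card_measurable:
  assumes "B \<in> sets borel" "bounded B"
  shows "(\<lambda>\<omega>. card {z. X z \<omega> \<in> B}) \<in> measurable M (count_space UNIV)"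
proof -
  have "indep_vars (\<lambda>_. count_space UNIV) (\<lambda>i \<omega>. card {z. X z \<omega> \<in> (\<lambda>_. B) i}) {0::nat}"
    by (rule ppp_indep) (use assms in \<open>auto simp: disjoint_family_on_def\<close>)
  then show ?thesis
    by (simp add: indep_vars_def)
qed

lemma ppp_finite_card_prob:
  assumes "B \<in> sets borel" "bounded B"
  shows "prob {\<omega>\<in>space M. finite {z. X z \<omega> \<in> B} \<and> card {z. X z \<omega> \<in> B} = k}
     = (c * measure lborel B) ^ k / fact k * exp (- (c * measure lborel B))"
  using ppp assms by (auto simp: homogeneous_ppp_def)

lemma ppp_finite_card_sets:
  assumes "B \<in> sets borel" "bounded B"
  shows "{\<omega>\<in>space M. finite {z. X z \<omega> \<in> B} \<and> card {z. X z \<omega> \<in> B} = k} \<in> sets M"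
proof -
  have "{\<omega>\<in>space M. card {z. X z \<omega> \<in> B} = k} \<in> sets M"
    using measurable_sets[OF ppp_card_measurable[OF assms], of "{k}"]
    by (simp add: vimage_def Int_def conj_commute)
  moreover have "{\<omega>\<in>space M. finite {z. X z \<omega> \<in> B}} \<in> sets M"
    using assms by (intro measurable_ppp_finite ppp_points_measurable)
  ultimately show ?thesis
    by (auto dest: sets.Int simp: Collect_conj_eq[symmetric] Int_def conj_commute conj_left_commute cong: conj_cong)
qed

lemma ppp_AE_finite:
  assumes B: "B \<in> sets borel" "bounded B"
  shows "AE \<omega> in M. finite {z. X z \<omega> \<in> B}"
proof -
  let ?m = "c * measure lborel B"
  let ?E = "\<lambda>k. {\<omega>\<in>space M. finite {z. X z \<omega> \<in> B} \<and> card {z. X z \<omega> \<in> B} = k}"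
  have "(\<lambda>k. prob (?E k)) sums prob (\<Union>k. ?E k)"
    using ppp_finite_card_sets[OF B]
    by (intro finite_measure_UNION) (auto simp: disjoint_family_on_def)
  moreover have "(\<lambda>k. prob (?E k)) sums 1"
  proof -
    have "(\<lambda>k. ?m ^ k /\<^sub>R fact k * exp (- ?m)) sums (exp ?m * exp (- ?m))"
      by (intro sums_mult2 exp_converges)
    then show ?thesis
      using B by (simp add: ppp_finite_card_prob exp_minus field_simps)
  qed
  ultimately have "prob (\<Union>k. ?E k) = 1"
    by (simp add: sums_unique2)
  then have "AE \<omega> in M. \<omega> \<in> (\<Union>k. ?E k)"
    by (rule AE_prob_1)
  then show ?thesis
    by eventually_elim auto
qed

lemma ppp_card_laplace:
  assumes B: "B \<in> sets borel" "bounded B" and t: "0 \<le> t"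
  shows "(\<integral>\<omega>. exp (- t) ^ card {z. X z \<omega> \<in> B} \<partial>M) = exp (- (c * measure lborel B * (1 - exp (- t))))"
proof -
  let ?m = "c * measure lborel B"
  let ?E = "\<lambda>k. {\<omega>\<in>space M. finite {z. X z \<omega> \<in> B} \<and> card {z. X z \<omega> \<in> B} = k}"
  have m0: "0 \<le> ?m" using c by simp
  note [measurable] = ppp_card_measurable[OF B]
  have E[measurable]: "?E k \<in> sets M" for k
    using ppp_finite_card_sets[OF B] .
  have "(\<integral>\<^sup>+\<omega>. ennreal (exp (- t) ^ card {z. X z \<omega> \<in> B}) \<partial>M)
      = (\<integral>\<^sup>+\<omega>. (\<Sum>k. ennreal (exp (- t) ^ k) * indicator (?E k) \<omega>) \<partial>M)"
  proof (intro nn_integral_cong_AE)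
    \<comment> \<open>This holds only almost everywhere: at an infinite set of points
      \<open>card\<close> is 0 and the left side is 1, but no event \<open>?E k\<close>
      occurs.\<close>
    show "AE \<omega> in M. ennreal (exp (- t) ^ card {z. X z \<omega> \<in> B})
        = (\<Sum>k. ennreal (exp (- t) ^ k) * indicator (?E k) \<omega>)"
      using ppp_AE_finite[OF B] AE_space
    proof eventually_elim
      case (elim \<omega>)
      have "(\<Sum>k. ennreal (exp (- t) ^ k) * indicator (?E k) \<omega>)
          = (\<Sum>k\<in>{card {z. X z \<omega> \<in> B}}. ennreal (exp (- t) ^ k) * indicator (?E k) \<omega>)"
        by (intro suminf_finite) (auto simp: indicator_def)
      then show ?case
        using elim by (simp add: indicator_def)
    qed
  qed
  also have "\<dots> = (\<Sum>k. ennreal (exp (- t) ^ k) * emeasure M (?E k))"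
    by (subst nn_integral_suminf) (auto simp: nn_integral_cmult)
  also have "\<dots> = (\<Sum>k. ennreal ((?m * exp (- t)) ^ k /\<^sub>R fact k * exp (- ?m)))"
    using B m0 by (intro suminf_cong)
      (simp add: emeasure_eq_measure ppp_finite_card_prob ennreal_mult'[symmetric] power_mult_distrib field_simps)
  also have "\<dots> = ennreal (exp (?m * exp (- t)) * exp (- ?m))"
    using m0 by (intro suminf_ennreal_eq sums_mult2 exp_converges) auto
  also have "exp (?m * exp (- t)) * exp (- ?m) = exp (- (?m * (1 - exp (- t))))"
    by (simp add: exp_add[symmetric] algebra_simps)
  finally show ?thesis
    using t by (intro integral_eq_nn_integral[THEN trans]) auto
qed

text \<open>On the disjoint level sets \<open>B i\<close> of the nonzero values, the sum over the
  points is a linear combination of counts. These are independent Poisson variables, so the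
  transform is the product of their generating functions.\<close>

lemma ppp_laplace_simple:
  fixes f :: "'a \<Rightarrow> ennreal"
  assumes sf: "simple_function borel f" and fin: "\<And>x. f x < \<top>" and bd: "bounded {x. f x \<noteq> 0}"
  shows "(\<integral>\<omega>. exp_neg (\<Sum>z. f (X z \<omega>)) \<partial>M)
    = exp_neg (ennreal c * (\<integral>\<^sup>+x. ennreal (1 - exp_neg (f x)) \<partial>lborel))"
proof -
  have "finite (range f - {0})"
    using sf by (auto simp: simple_function_def)
  \<comment> \<open>The nonzero values are numbered by naturals because
    \<open>homogeneous_ppp\<close> states independence for families indexed by
    \<open>nat\<close>.\<close>
  then obtain h where h: "bij_betw h {0..<card (range f - {0})} (range f - {0})"
    using ex_bij_betw_nat_finite by blast
  define I where "I = {0..<card (range f - {0})}"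
  have [simp]: "finite I" by (simp add: I_def)
  have hI: "h ` I = range f - {0}" and inj: "inj_on h I"
    using h by (auto simp: bij_betw_def I_def)
  define B where "B i = f -` {h i}" for i
  define t where "t i = enn2real (h i)" for i
  have h_fin: "h i < \<top>" "h i \<noteq> 0" if "i \<in> I" for i
    using hI fin that by (auto simp: set_eq_iff image_iff) (metis fin)+
  have t: "0 \<le> t i" "h i = ennreal (t i)" "exp_neg (h i) = exp (- t i)" if "i \<in> I" for i
    using h_fin[OF that] by (auto simp: t_def exp_neg_def less_top)
  have B_sets: "B i \<in> sets borel" for i
    using simple_functionD(2)[OF sf] by (simp add: B_def)
  have B_bd: "bounded (B i)" if "i \<in> I" for i
    by (rule bounded_subset[OF bd]) (use h_fin(2)[OF that] in \<open>auto simp: B_def\<close>)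
  have B_disj: "disjoint_family_on B I"
    using inj by (auto simp: disjoint_family_on_def B_def inj_on_def)
  have B_un: "{x. f x \<noteq> 0} = (\<Union>i\<in>I. B i)"
    using hI h_fin by (auto simp: B_def set_eq_iff image_iff)
  note [measurable] = B_sets ppp_points_measurable
  have card_meas[measurable]: "(\<lambda>\<omega>. card {z. X z \<omega> \<in> B i}) \<in> measurable M (count_space UNIV)" if "i \<in> I" for i
    using that by (intro ppp_card_measurable B_bd B_sets)

  have "(\<integral>\<omega>. exp_neg (\<Sum>z. f (X z \<omega>)) \<partial>M)
      = (\<integral>\<omega>. (\<Prod>i\<in>I. exp (- t i) ^ card {z. X z \<omega> \<in> B i}) \<partial>M)"
  proof (intro integral_cong_AE)
    show "AE \<omega> in M. exp_neg (\<Sum>z. f (X z \<omega>)) = (\<Prod>i\<in>I. exp (- t i) ^ card {z. X z \<omega> \<in> B i})"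
    proof -
      \<comment> \<open>An infinite count would break the identity: \<open>card\<close> would be 0
        while the sum over the points is infinite.\<close>
      have "AE \<omega> in M. \<forall>i\<in>I. finite {z. X z \<omega> \<in> B i}"
        by (intro AE_finite_allI ppp_AE_finite B_bd B_sets) auto
      then show ?thesis
      proof eventually_elim
        case (elim \<omega>)
        define Z where "Z i = {z. X z \<omega> \<in> B i}" for i
        have Z: "finite (Z i)" if "i \<in> I" for i
          using elim that by (auto simp: Z_def)
        have "(\<Sum>z. f (X z \<omega>)) = (\<Sum>z\<in>(\<Union>i\<in>I. Z i). f (X z \<omega>))"
          using Z B_un by (intro suminf_finite) (auto simp: Z_def)
        then have "exp_neg (\<Sum>z. f (X z \<omega>)) = (\<Prod>z\<in>(\<Union>i\<in>I. Z i). exp_neg (f (X z \<omega>)))"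
          by (simp add: exp_neg_sum)
        also have "\<dots> = (\<Prod>i\<in>I. \<Prod>z\<in>Z i. exp_neg (f (X z \<omega>)))"
          using Z B_disj by (intro prod.UNION_disjoint) (auto simp: Z_def disjoint_family_on_def)
        also have "\<dots> = (\<Prod>i\<in>I. \<Prod>z\<in>Z i. exp (- t i))"
          by (intro prod.cong refl) (simp add: Z_def B_def t(3))
        finally show ?case
          by (simp add: Z_def)
      qed
    qed
    show "(\<lambda>\<omega>. exp_neg (\<Sum>z. f (X z \<omega>))) \<in> borel_measurable M"
      using borel_measurable_simple_function[OF sf] by measurable
  qed measurable
  also have "\<dots> = (\<Prod>i\<in>I. \<integral>\<omega>. exp (- t i) ^ card {z. X z \<omega> \<in> B i} \<partial>M)"
  proof (intro indep_vars_lebesgue_integral)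
    show "indep_vars (\<lambda>_. borel) (\<lambda>i \<omega>. exp (- t i) ^ card {z. X z \<omega> \<in> B i}) I"
      using B_disj B_bd
      by (intro indep_vars_compose2[OF ppp_indep, where Y = "\<lambda>i k. exp (- t i) ^ k"]) auto
    show "integrable M (\<lambda>\<omega>. exp (- t i) ^ card {z. X z \<omega> \<in> B i})" if "i \<in> I" for i
      using t that by (intro integrable_const_bound[where B=1] AE_I2) (auto intro!: power_le_one)
  qed simp
  also have "\<dots> = (\<Prod>i\<in>I. exp (- (c * measure lborel (B i) * (1 - exp (- t i)))))"
    using t B_bd by (intro prod.cong refl ppp_card_laplace) auto
  also have "\<dots> = exp (- (c * (\<Sum>i\<in>I. (1 - exp (- t i)) * measure lborel (B i))))"
    by (simp add: exp_sum[symmetric] sum_negf sum_distrib_left mult_ac)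
  also have "\<dots> = exp_neg (ennreal c * ennreal (\<Sum>i\<in>I. (1 - exp (- t i)) * measure lborel (B i)))"
    using c t by (subst ennreal_mult'[symmetric], simp, subst exp_neg_ennreal)
      (auto intro!: mult_nonneg_nonneg sum_nonneg)
  also have "ennreal (\<Sum>i\<in>I. (1 - exp (- t i)) * measure lborel (B i))
      = (\<Sum>i\<in>I. ennreal (1 - exp (- t i)) * emeasure lborel (B i))"
    using t emeasure_bounded_finite[OF B_bd]
    by (subst sum_ennreal[symmetric])
       (auto intro!: sum.cong simp: ennreal_mult emeasure_eq_ennreal_measure less_top)
  also have "\<dots> = (\<integral>\<^sup>+x. (\<Sum>i\<in>I. ennreal (1 - exp (- t i)) * indicator (B i) x) \<partial>lborel)"
    by (subst nn_integral_sum) (auto simp: nn_integral_cmult)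
  also have "\<dots> = (\<integral>\<^sup>+x. ennreal (1 - exp_neg (f x)) \<partial>lborel)"
  proof (intro nn_integral_cong)
    fix x
    show "(\<Sum>i\<in>I. ennreal (1 - exp (- t i)) * indicator (B i) x) = ennreal (1 - exp_neg (f x))"
    proof (cases "f x = 0")
      case True
      then show ?thesis
        using h_fin(2) by (auto intro!: sum.neutral simp: B_def indicator_def)
    next
      case False
      then obtain j where j: "j \<in> I" "h j = f x"
        using hI by (metis (no_types, lifting) DiffI image_iff rangeI singletonD)
      have "(\<Sum>i\<in>I. ennreal (1 - exp (- t i)) * indicator (B i) x)
          = (\<Sum>i\<in>I. if i = j then ennreal (1 - exp (- t j)) else 0)"
        using j inj by (intro sum.cong refl) (auto simp: B_def indicator_def inj_on_def)
      then show ?thesis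
        using j t(3)[of j] by simp
    qed
  qed
  finally show ?thesis .
qed

text \<open>Both sides pass to the limit along increasing approximations: the left by dominated
  convergence with bound 1, the right because the losses \<open>1 - exp_neg (f' i x)\<close>
  increase with i.\<close>

lemma ppp_laplace:
  fixes f :: "'a \<Rightarrow> ennreal"
  assumes [measurable]: "f \<in> borel_measurable borel"
  shows "(\<integral>\<omega>. exp_neg (\<Sum>z. f (X z \<omega>)) \<partial>M)
    = exp_neg (ennreal c * (\<integral>\<^sup>+x. ennreal (1 - exp_neg (f x)) \<partial>lborel))"
proof -
  note [measurable] = ppp_points_measurable
  obtain F where F: "\<And>i. simple_function borel (F i)" "incseq F"
    "\<And>i x. F i x < \<top>" "\<And>x. (SUP i. F i x) = f x"
    using borel_measurable_implies_simple_function_sequence'[OF assms] by metis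
  \<comment> \<open>The cut to a ball supplies bounded support, which a simple function below f need
    not have; the growing balls lose no point in the limit.\<close>
  define f' where "f' i x = F i x * indicator (ball 0 (real i)) x" for i :: nat and x
  have [measurable]: "F i \<in> borel_measurable borel" for i
    by (intro borel_measurable_simple_function F)
  have [measurable]: "ball (0::'a) (real i) \<in> sets borel" for i
    by (intro borel_open open_ball)
  have [measurable]: "f' i \<in> borel_measurable borel" for i
    unfolding f'_def by measurable
  have mono: "f' i x \<le> f' j x" if "i \<le> j" for i j x
    using that F(2) by (auto simp: f'_def indicator_def mono_def le_fun_def)
  have lim: "(\<lambda>i. f' i x) \<longlonglongrightarrow> f x" for x
  proof (rule Lim_transform_eventually)
    show "(\<lambda>i. F i x) \<longlonglongrightarrow> f x"
      using F(2) unfolding F(4)[symmetric] by (intro LIMSEQ_SUP) (auto simp: mono_def le_fun_def)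
    show "\<forall>\<^sub>F i in sequentially. F i x = f' i x"
      using eventually_gt_at_top[of "nat \<lceil>norm x\<rceil>"]
    proof eventually_elim
      case (elim i)
      then have "norm x < real i" by linarith
      then show ?case by (simp add: f'_def)
    qed
  qed
  have simple: "(\<integral>\<omega>. exp_neg (\<Sum>z. f' i (X z \<omega>)) \<partial>M)
    = exp_neg (ennreal c * (\<integral>\<^sup>+x. ennreal (1 - exp_neg (f' i x)) \<partial>lborel))" for i
  proof (rule ppp_laplace_simple)
    show "simple_function borel (f' i)"
      unfolding f'_def by (intro simple_function_mult F simple_function_indicator borel_open open_ball)
    show "f' i x < \<top>" for x
      using F(3) by (auto simp: f'_def indicator_def)
    show "bounded {x. f' i x \<noteq> 0}"
      by (rule bounded_subset[OF bounded_ball[of 0 "real i"]]) (auto simp: f'_def indicator_def split: if_splits)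
  qed
  have "(\<lambda>i. \<integral>\<omega>. exp_neg (\<Sum>z. f' i (X z \<omega>)) \<partial>M) \<longlonglongrightarrow> (\<integral>\<omega>. exp_neg (\<Sum>z. f (X z \<omega>)) \<partial>M)"
  proof (intro integral_dominated_convergence[where w="\<lambda>_. 1"] AE_I2 tendsto_exp_neg)
    fix \<omega>
    \<comment> \<open>The sum over the points is read as an integral for counting measure, so that
      monotone convergence applies to it.\<close>
    have "(\<lambda>i. \<integral>\<^sup>+z. f' i (X z \<omega>) \<partial>count_space UNIV) \<longlonglongrightarrow> (\<integral>\<^sup>+z. f (X z \<omega>) \<partial>count_space UNIV)"
      using mono lim by (intro nn_integral_LIMSEQ) (auto simp: mono_def le_fun_def)
    then show "(\<lambda>i. \<Sum>z. f' i (X z \<omega>)) \<longlonglongrightarrow> (\<Sum>z. f (X z \<omega>))"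
      by (simp add: nn_integral_count_space_nat)
  qed auto
  moreover have "(\<lambda>i. exp_neg (ennreal c * (\<integral>\<^sup>+x. ennreal (1 - exp_neg (f' i x)) \<partial>lborel)))
      \<longlonglongrightarrow> exp_neg (ennreal c * (\<integral>\<^sup>+x. ennreal (1 - exp_neg (f x)) \<partial>lborel))"
    using mono
    by (intro tendsto_exp_neg ennreal_tendsto_cmult nn_integral_LIMSEQ tendsto_ennrealI tendsto_intros lim)
       (auto simp: mono_def le_fun_def intro!: ennreal_leI exp_neg_antimono)
  ultimately show ?thesis
    unfolding simple by (rule LIMSEQ_unique)
qed

end

section \<open>Polar coordinates and Gamma fading\<close>

text \<open>Both measures give the half line up to a the area of the disc of radius a, and half
  lines form an intersection-stable generator of the Borel sets.\<close>

lemma distr_lborel_norm_real2: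
  "distr lborel borel (norm :: real^2 \<Rightarrow> real) = density lborel (\<lambda>r. ennreal (2 * pi * r))"
proof (rule measure_eqI_generator_eq)
  let ?E = "range (\<lambda>a::real. {..a})"
  have lhs: "emeasure (distr lborel borel (norm :: real^2 \<Rightarrow> real)) {..a}
      = (if a < 0 then 0 else ennreal (pi * a\<^sup>2))" for a
  proof -
    have *: "(norm :: real^2 \<Rightarrow> real) -` {..a} = cball 0 a"
      by (auto simp: dist_norm)
    show ?thesis
      using * by (subst emeasure_distr) (auto simp: emeasure_cball unit_ball_vol_2)
  qed
  have rhs: "emeasure (density lborel (\<lambda>r. ennreal (2 * pi * r))) {..a}
      = (if a < 0 then 0 else ennreal (pi * a\<^sup>2))" for a
  proof -
    have "emeasure (density lborel (\<lambda>r. ennreal (2 * pi * r))) {..a}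
        = (\<integral>\<^sup>+r. ennreal (2 * pi * r) * indicator {..a} r \<partial>lborel)"
      by (subst emeasure_density) auto
    \<comment> \<open>\<open>ennreal\<close> turns negative values of 2 pi r into 0, so the density
      lives on r \<ge> 0.\<close>
    also have "\<dots> = (\<integral>\<^sup>+r. ennreal (2 * pi * r) * indicator {0..a} r \<partial>lborel)"
      by (intro nn_integral_cong) (auto simp: indicator_def ennreal_neg mult_le_0_iff)
    also have "\<dots> = (if a < 0 then 0 else ennreal (pi * a\<^sup>2))"
    proof (cases "a < 0")
      case False
      then have "(\<integral>\<^sup>+r. ennreal (2 * pi * r) * indicator {0..a} r \<partial>lborel) = ennreal (pi * a\<^sup>2 - pi * 0\<^sup>2)"
        by (intro nn_integral_FTC_Icc) (auto intro!: derivative_eq_intros)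
      then show ?thesis using False by simp
    qed auto
    finally show ?thesis .
  qed
  show "Int_stable ?E"
    by (auto simp: Int_stable_def)
  show "emeasure (distr lborel borel (norm :: real^2 \<Rightarrow> real)) X = emeasure (density lborel (\<lambda>r. ennreal (2 * pi * r))) X"
    if "X \<in> ?E" for X
    using that lhs rhs by auto
  show "sets (distr lborel borel (norm :: real^2 \<Rightarrow> real)) = sigma_sets UNIV ?E"
    by (simp add: borel_eq_atMost)
  show "sets (density lborel (\<lambda>r. ennreal (2 * pi * r))) = sigma_sets UNIV ?E"
    by (simp add: borel_eq_atMost)
  show "range (\<lambda>i::nat. {..real i}) \<subseteq> ?E" by auto
  show "(\<Union>i::nat. {..real i}) = UNIV"
    by (auto intro: real_arch_simple)
  show "emeasure (distr lborel borel (norm :: real^2 \<Rightarrow> real)) {..real i} \<noteq> \<infinity>" for i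
    unfolding lhs by auto
qed auto

lemma nn_integral_norm_real2:
  assumes [measurable]: "h \<in> borel_measurable borel"
  shows "(\<integral>\<^sup>+x. h (norm (x::real^2)) \<partial>lborel) = (\<integral>\<^sup>+r. ennreal (2 * pi * r) * h r \<partial>lborel)"
proof -
  have "(\<integral>\<^sup>+x. h (norm (x::real^2)) \<partial>lborel) = (\<integral>\<^sup>+r. h r \<partial>distr lborel borel (norm :: real^2 \<Rightarrow> real))"
    by (subst nn_integral_distr) auto
  then show ?thesis
    unfolding distr_lborel_norm_real2 by (simp add: nn_integral_density)
qed

section \<open>Laplace transform of the Gamma fading\<close>

lemma nn_integral_erlang_density:
  assumes "0 < l"
  shows "(\<integral>\<^sup>+x. ennreal (erlang_density k l x) \<partial>lborel) = 1"
  using nn_integral_erlang_ith_moment[OF assms, of k 0] by simp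

text \<open>Exponential tilting: an Erlang density of rate l times exp (-t x) is, up to a constant,
  the Erlang density of rate l + t with the same shape, whose mass is 1.\<close>

lemma nn_integral_erlang_exp:
  assumes l: "0 < l" and t: "0 \<le> t"
  shows "(\<integral>\<^sup>+x. ennreal (erlang_density k l x * exp (- (t * x))) \<partial>lborel) = ennreal ((l / (l + t)) ^ Suc k)"
proof -
  have *: "erlang_density k l x * exp (- (t * x)) = (l / (l + t)) ^ Suc k * erlang_density k (l + t) x" for x
  proof (cases "x < 0")
    case False
    have "(l + t) ^ Suc k \<noteq> 0" using assms by simp
    moreover have "exp (- (l + t) * x) = exp (- l * x) * exp (- (t * x))"
      by (simp add: exp_add[symmetric] algebra_simps)
    ultimately show ?thesis
      using False by (simp add: erlang_density_def power_divide del: power_Suc)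
  qed (simp add: erlang_density_def)
  have "(\<integral>\<^sup>+x. ennreal (erlang_density k l x * exp (- (t * x))) \<partial>lborel)
      = (\<integral>\<^sup>+x. ennreal ((l / (l + t)) ^ Suc k) * ennreal (erlang_density k (l + t) x) \<partial>lborel)"
    using assms unfolding * by (intro nn_integral_cong ennreal_mult') auto
  also have "\<dots> = ennreal ((l / (l + t)) ^ Suc k)"
    using assms by (subst nn_integral_cmult) (auto simp: nn_integral_erlang_density)
  finally show ?thesis .
qed

lemma fading_F_nonneg: "0 \<le> y \<Longrightarrow> 0 \<le> fading_F n y"
  by (simp add: fading_F_def)

lemma fading_F_measurable [measurable]: "fading_F n \<in> borel_measurable borel"
  unfolding fading_F_def by measurable

text \<open>This is the origin of \<open>fading_F\<close>: one minus the Laplace transform at t of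
  the Gamma law with shape N and mean 1. The maximum matches the truncation of negative interference
  and is invisible to a density carried by x \<ge> 0.\<close>

lemma nn_integral_fading:
  assumes N: "1 \<le> N" and t: "0 \<le> t"
  shows "(\<integral>\<^sup>+x. ennreal (erlang_density (N - 1) (real N) x) * ennreal (1 - exp (- (t * max 0 x))) \<partial>lborel)
    = ennreal (fading_F N (t / real N))"
proof -
  let ?e = "erlang_density (N - 1) (real N)"
  let ?I = "\<integral>\<^sup>+x. ennreal (?e x) * ennreal (1 - exp (- (t * max 0 x))) \<partial>lborel"
  let ?q = "(real N / (real N + t)) ^ N"
  \<comment> \<open>Adding the Laplace transform restores the full density, of mass 1; being finite,
    \<open>?q\<close> can be cancelled afterwards.\<close>
  have "?I + ennreal ?q = ?I + (\<integral>\<^sup>+x. ennreal (?e x * exp (- (t * x))) \<partial>lborel)"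
    using N t by (subst nn_integral_erlang_exp) auto
  also have "\<dots> = (\<integral>\<^sup>+x. ennreal (?e x) * ennreal (1 - exp (- (t * max 0 x))) + ennreal (?e x * exp (- (t * x))) \<partial>lborel)"
    by (subst nn_integral_add) auto
  also have "\<dots> = (\<integral>\<^sup>+x. ennreal (?e x) \<partial>lborel)"
  proof (intro nn_integral_cong)
    fix x :: real
    show "ennreal (?e x) * ennreal (1 - exp (- (t * max 0 x))) + ennreal (?e x * exp (- (t * x))) = ennreal (?e x)"
    proof (cases "x < 0")
      case False
      define a where "a = ?e x"
      define b where "b = exp (- (t * x))"
      have "0 \<le> a" "0 \<le> b" "b \<le> 1"
        using False t by (auto simp: a_def b_def)
      then have "ennreal a * ennreal (1 - b) + ennreal (a * b) = ennreal (a * (1 - b) + a * b)"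
        by (subst ennreal_plus) (auto simp: ennreal_mult' intro!: mult_nonneg_nonneg)
      moreover have "max 0 x = x" using False by simp
      ultimately show ?thesis
        by (simp only: a_def[symmetric] b_def[symmetric]) (simp add: right_diff_distrib)
    qed (simp add: erlang_density_def)
  qed
  also have "\<dots> = 1"
    using N by (simp add: nn_integral_erlang_density)
  finally have "?I + ennreal ?q = 1" .
  then have "?I = 1 - ennreal ?q"
    by (metis ennreal_add_diff_cancel_right ennreal_neq_top)
  also have "\<dots> = ennreal (1 - ?q)"
    using N t by (subst ennreal_minus[symmetric]) auto
  also have "1 - ?q = fading_F N (t / real N)"
  proof -
    have "1 + t / real N = (real N + t) / real N" using N by (simp add: field_simps)
    then show ?thesis by (simp add: fading_F_def power_divide)
  qed
  finally show ?thesis .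
qed

section \<open>Change of variables in the radial integral\<close>

text \<open>With $r = (q p)^{1/\alpha} y$ the cutoff condition $p\, r^{-\alpha} < \rho$ becomes
  $y > (\rho q)^{-1/\alpha}$, independently of $p$.\<close>

lemma nn_integral_radial_substitution:
  fixes w :: "real \<Rightarrow> real"
  assumes p: "0 < p" and q: "0 < q" and \<alpha>: "0 < \<alpha>" and \<rho>: "0 < \<rho>"
    and [measurable]: "w \<in> borel_measurable borel" and w: "\<And>r. 0 \<le> r \<Longrightarrow> 0 \<le> w r"
  shows "(\<integral>\<^sup>+r. ennreal (2 * pi * r) * (ennreal (w r) *
        (indicator {r. p * r powr (- \<alpha>) < \<rho>} r * ennreal (fading_F N (q * p * r powr (- \<alpha>) / real N)))) \<partial>lborel)
    = ennreal (2 * pi * q powr (2 / \<alpha>)) *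
      (\<integral>\<^sup>+y\<in>{(\<rho> * q) powr (- 1 / \<alpha>)..}. ennreal (fading_F N (y powr (- \<alpha>) / real N)
          * w ((q * p) powr (1 / \<alpha>) * y) * y * p powr (2 / \<alpha>)) \<partial>lborel)"
    (is "?L = ?R")
proof -
  define c where "c = (q * p) powr (1 / \<alpha>)"
  define A where "A = (\<rho> * q) powr (- 1 / \<alpha>)"
  have c: "0 < c" using p q by (simp add: c_def)
  have A: "0 < A" using \<rho> q by (simp add: A_def)
  have c\<alpha>: "c powr (- \<alpha>) = 1 / (q * p)"
    using p q \<alpha> by (simp add: c_def powr_powr powr_minus_divide)
  \<comment> \<open>One factor c is the Jacobian of r = c y, the other comes from the planar weight
    2 pi r.\<close>
  have c2: "c * c = q powr (2 / \<alpha>) * p powr (2 / \<alpha>)"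
    using p q by (simp add: c_def powr_mult powr_add[symmetric] mult_ac)
  let ?f = "\<lambda>r. ennreal (2 * pi * r) * (ennreal (w r) *
        (indicator {r. p * r powr (- \<alpha>) < \<rho>} r * ennreal (fading_F N (q * p * r powr (- \<alpha>) / real N))))"
  have "?L = ennreal c * (\<integral>\<^sup>+y. ?f (0 + c * y) \<partial>lborel)"
    using c by (subst nn_integral_real_affine[where c=c and t=0]) auto
  also have "\<dots> = (\<integral>\<^sup>+y. ennreal c * ?f (c * y) \<partial>lborel)"
    by (subst nn_integral_cmult[symmetric]) auto
  also have "\<dots> = (\<integral>\<^sup>+y. ennreal (2 * pi * q powr (2 / \<alpha>)) * (ennreal (fading_F N (y powr (- \<alpha>) / real N)
          * w (c * y) * y * p powr (2 / \<alpha>)) * indicator {A..} y) \<partial>lborel)"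
  proof (intro nn_integral_cong_AE)
    show "AE y in lborel. ennreal c * ?f (c * y) = ennreal (2 * pi * q powr (2 / \<alpha>)) *
      (ennreal (fading_F N (y powr (- \<alpha>) / real N) * w (c * y) * y * p powr (2 / \<alpha>)) * indicator {A..} y)"
      \<comment> \<open>The cutoff yields A < y while the integral runs over A \<le> y; the point A
        is discarded as a null set.\<close>
      using AE_lborel_singleton[of A]
    proof eventually_elim
      case (elim y)
      show ?case
      proof (cases "0 < y")
        \<comment> \<open>Here both sides vanish: on the left \<open>ennreal\<close> truncates the
          weight, on the right y lies below the positive A.\<close>
        case False
        then show ?thesis
          using A c by (simp add: indicator_def ennreal_neg mult_le_0_iff not_less)
      next
        case True
        have *: "(c * y) powr (- \<alpha>) = y powr (- \<alpha>) / (q * p)"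
          using c True by (simp add: powr_mult c\<alpha>)
        have "p * (c * y) powr (- \<alpha>) < \<rho> \<longleftrightarrow> y powr (- \<alpha>) < \<rho> * q"
          using p q by (simp add: * field_simps)
        also have "\<dots> \<longleftrightarrow> A < y"
        proof -
          have "A powr (- \<alpha>) = \<rho> * q"
            using \<rho> q \<alpha> by (simp add: A_def powr_powr)
          then show ?thesis
            using A True \<alpha> powr_less_mono2_neg[of "- \<alpha>" A y] powr_less_mono2_neg[of "- \<alpha>" y A]
            by (cases A y rule: linorder_cases) auto
        qed
        also have "\<dots> \<longleftrightarrow> A \<le> y"
          using elim by auto
        finally have ind: "indicator {r. p * r powr (- \<alpha>) < \<rho>} (c * y) = (indicator {A..} y :: ennreal)"
          by (simp add: indicator_def)
        have F: "q * p * (c * y) powr (- \<alpha>) / real N = y powr (- \<alpha>) / real N"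
          using p q by (simp add: *)
        have nn: "0 \<le> w (c * y)" "0 \<le> fading_F N (y powr (- \<alpha>) / real N)"
          using w[of "c * y"] True c by (auto intro: fading_F_nonneg)
        have "ennreal c * (ennreal (2 * pi * (c * y)) * (ennreal (w (c * y)) * ennreal (fading_F N (y powr (- \<alpha>) / real N))))
            = ennreal (2 * pi * (c * c) * (fading_F N (y powr (- \<alpha>) / real N) * w (c * y) * y))"
          using c True nn by (simp add: ennreal_mult[symmetric] mult_ac)
        also have "\<dots> = ennreal (2 * pi * q powr (2 / \<alpha>)) *
            ennreal (fading_F N (y powr (- \<alpha>) / real N) * w (c * y) * y * p powr (2 / \<alpha>))"
          unfolding c2 by (subst ennreal_mult'[symmetric]) (auto simp: mult_ac)
        finally show ?thesis
          unfolding ind F by (simp add: indicator_def)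
      qed
    qed
  qed
  also have "\<dots> = ?R"
    unfolding c_def[symmetric] A_def[symmetric] by (subst nn_integral_cmult) auto
  finally show ?thesis .
qed

lemma nn_integral_cmult_cmult:
  assumes "h \<in> borel_measurable M"
  shows "(\<integral>\<^sup>+x. a * (b * h x) \<partial>M) = b * (a * (\<integral>\<^sup>+x. h x \<partial>M))"
  using assms by (simp add: nn_integral_cmult ac_simps)

text \<open>The scale (q p)^(1/\<alpha>) of the radius depends on p. Tonelli therefore first moves
  the radial integral inside the one over p; the substitution is made at fixed p, and then the order
  is restored.\<close>

lemma nn_integral_planar_interference:
  fixes w f :: "real \<Rightarrow> real"
  assumes q: "0 < q" and \<alpha>: "0 < \<alpha>" and \<rho>: "0 < \<rho>"
    and [measurable]: "w \<in> borel_measurable borel" and w: "\<And>r. 0 \<le> r \<Longrightarrow> 0 \<le> w r"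
    and f[measurable]: "(\<lambda>p. ennreal (f p)) \<in> borel_measurable borel"
    and supp: "\<And>p. p \<notin> {0..b} \<Longrightarrow> f p = 0"
  shows "(\<integral>\<^sup>+x. ennreal (w (norm (x::real^2))) * (\<integral>\<^sup>+p. ennreal (f p) *
        (indicator {p. p * norm x powr (- \<alpha>) < \<rho>} p * ennreal (fading_F N (q * p * norm x powr (- \<alpha>) / real N))) \<partial>lborel) \<partial>lborel)
    = ennreal (2 * pi * q powr (2 / \<alpha>)) *
      (\<integral>\<^sup>+y\<in>{(\<rho> * q) powr (- 1 / \<alpha>)..}. (\<integral>\<^sup>+p\<in>{0..b}. ennreal (fading_F N (y powr (- \<alpha>) / real N)
          * w ((q * p) powr (1 / \<alpha>) * y) * y * p powr (2 / \<alpha>) * f p) \<partial>lborel) \<partial>lborel)"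
    (is "?L = ?R")
proof -
  let ?k = "\<lambda>r p. ennreal (fading_F N (q * p * r powr (- \<alpha>) / real N))"
  let ?i = "\<lambda>r p. indicator {r. p * r powr (- \<alpha>) < \<rho>} r :: ennreal"
  let ?A = "(\<rho> * q) powr (- 1 / \<alpha>)"
  let ?h = "\<lambda>y p. fading_F N (y powr (- \<alpha>) / real N) * w ((q * p) powr (1 / \<alpha>) * y) * y * p powr (2 / \<alpha>)"
  have A: "0 < ?A" using \<rho> q by simp
  have inner: "(\<integral>\<^sup>+p. ennreal (f p) * (ennreal (?h y p) * indicator {?A..} y) \<partial>lborel)
      = (\<integral>\<^sup>+p\<in>{0..b}. ennreal (?h y p * f p) \<partial>lborel) * indicator {?A..} y" for y
  proof (cases "?A \<le> y")
    case True
    have "0 \<le> ?h y p" for p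
      using order.trans[OF less_imp_le[OF A] True] by (intro mult_nonneg_nonneg fading_F_nonneg w) auto
    \<comment> \<open>With \<open>?h\<close> nonnegative the product rule holds for either sign of
      \<open>f p\<close>, a negative value being truncated to 0 on both sides.\<close>
    then have "ennreal (?h y p * f p) = ennreal (?h y p) * ennreal (f p)" for p
      by (rule ennreal_mult')
    then show ?thesis
      using True supp by (auto intro!: nn_integral_cong simp: indicator_def mult_ac)
  qed simp
  have "?L = (\<integral>\<^sup>+x. (\<lambda>r. ennreal (w r) * (\<integral>\<^sup>+p. ennreal (f p) * (?i r p * ?k r p) \<partial>lborel)) (norm (x::real^2)) \<partial>lborel)"
    by (simp add: indicator_def)
  also have "\<dots> = (\<integral>\<^sup>+r. ennreal (2 * pi * r) * (ennreal (w r) * (\<integral>\<^sup>+p. ennreal (f p) * (?i r p * ?k r p) \<partial>lborel)) \<partial>lborel)"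
    by (rule nn_integral_norm_real2) (unfold indicator_def, measurable)
  also have "\<dots> = (\<integral>\<^sup>+r. (\<integral>\<^sup>+p. ennreal (f p) * (ennreal (2 * pi * r) * (ennreal (w r) * (?i r p * ?k r p))) \<partial>lborel) \<partial>lborel)"
  proof (intro nn_integral_cong)
    fix r :: real
    have "(\<lambda>p. ennreal (f p) * (?i r p * ?k r p)) \<in> borel_measurable lborel"
      unfolding indicator_def by measurable
    then have "(\<integral>\<^sup>+p. (ennreal (2 * pi * r) * ennreal (w r)) * (ennreal (f p) * (?i r p * ?k r p)) \<partial>lborel)
        = (ennreal (2 * pi * r) * ennreal (w r)) * (\<integral>\<^sup>+p. ennreal (f p) * (?i r p * ?k r p) \<partial>lborel)"
      by (rule nn_integral_cmult)
    then show "ennreal (2 * pi * r) * (ennreal (w r) * (\<integral>\<^sup>+p. ennreal (f p) * (?i r p * ?k r p) \<partial>lborel))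
        = (\<integral>\<^sup>+p. ennreal (f p) * (ennreal (2 * pi * r) * (ennreal (w r) * (?i r p * ?k r p))) \<partial>lborel)"
      by (simp add: mult_ac)
  qed
  also have "\<dots> = (\<integral>\<^sup>+p. (\<integral>\<^sup>+r. ennreal (f p) * (ennreal (2 * pi * r) * (ennreal (w r) * (?i r p * ?k r p))) \<partial>lborel) \<partial>lborel)"
    by (intro lborel_pair.Fubini') (unfold indicator_def, measurable)
  also have "\<dots> = (\<integral>\<^sup>+p. ennreal (f p) * (\<integral>\<^sup>+r. ennreal (2 * pi * r) * (ennreal (w r) * (?i r p * ?k r p)) \<partial>lborel) \<partial>lborel)"
    by (intro nn_integral_cong nn_integral_cmult) (unfold indicator_def, measurable)
  also have "\<dots> = (\<integral>\<^sup>+p. ennreal (f p) * (ennreal (2 * pi * q powr (2 / \<alpha>)) *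
      (\<integral>\<^sup>+y\<in>{?A..}. ennreal (?h y p) \<partial>lborel)) \<partial>lborel)"
  proof (intro nn_integral_cong_AE)
    show "AE p in lborel. ennreal (f p) * (\<integral>\<^sup>+r. ennreal (2 * pi * r) * (ennreal (w r) * (?i r p * ?k r p)) \<partial>lborel)
        = ennreal (f p) * (ennreal (2 * pi * q powr (2 / \<alpha>)) * (\<integral>\<^sup>+y\<in>{?A..}. ennreal (?h y p) \<partial>lborel))"
      \<comment> \<open>The substitution needs p > 0; the point 0 is a null set and \<open>f\<close>
        vanishes at negative p.\<close>
      using AE_lborel_singleton[of 0]
    proof eventually_elim
      case (elim p)
      show ?case
      proof (cases "0 < p")
        case True
        then show ?thesis
          by (subst nn_integral_radial_substitution) (use assms in auto)
      next
        case False
        then have "f p = 0" using elim by (intro supp) auto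
        then show ?thesis by simp
      qed
    qed
  qed
  also have "\<dots> = (\<integral>\<^sup>+p. (\<integral>\<^sup>+y. ennreal (2 * pi * q powr (2 / \<alpha>)) * (ennreal (f p) * (ennreal (?h y p) * indicator {?A..} y)) \<partial>lborel) \<partial>lborel)"
    by (intro nn_integral_cong nn_integral_cmult_cmult[symmetric]) measurable
  also have "\<dots> = (\<integral>\<^sup>+y. (\<integral>\<^sup>+p. ennreal (2 * pi * q powr (2 / \<alpha>)) * (ennreal (f p) * (ennreal (?h y p) * indicator {?A..} y)) \<partial>lborel) \<partial>lborel)"
    by (intro lborel_pair.Fubini') measurable
  also have "\<dots> = (\<integral>\<^sup>+y. ennreal (2 * pi * q powr (2 / \<alpha>)) * (\<integral>\<^sup>+p. ennreal (f p) * (ennreal (?h y p) * indicator {?A..} y) \<partial>lborel) \<partial>lborel)"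
    by (intro nn_integral_cong nn_integral_cmult) measurable
  also have "\<dots> = ennreal (2 * pi * q powr (2 / \<alpha>)) * (\<integral>\<^sup>+y. (\<integral>\<^sup>+p. ennreal (f p) * (ennreal (?h y p) * indicator {?A..} y) \<partial>lborel) \<partial>lborel)"
    by (intro nn_integral_cmult) measurable
  also have "\<dots> = ?R"
    unfolding inner ..
  finally show ?thesis .
qed

section \<open>Averaging over marks and LOS indicators\<close>

text \<open>The constant \<^const>\<open>prob_space.indep_var\<close> forces both variables to have the same type; independence of
  the generated algebras does not.\<close>

lemma (in prob_space) distr_pair_indep_set:
  assumes X[measurable]: "X \<in> measurable M S" and Y[measurable]: "Y \<in> measurable M T"
    and ind: "indep_set (sets (vimage_algebra (space M) X S)) (sets (vimage_algebra (space M) Y T))"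
  shows "distr M S X \<Otimes>\<^sub>M distr M T Y = distr M (S \<Otimes>\<^sub>M T) (\<lambda>\<omega>. (X \<omega>, Y \<omega>))"
proof (rule pair_measure_eqI)
  interpret X: prob_space "distr M S X" by (rule prob_space_distr) fact
  interpret Y: prob_space "distr M T Y" by (rule prob_space_distr) fact
  show "sigma_finite_measure (distr M S X)" "sigma_finite_measure (distr M T Y)" ..
  fix A B assume "A \<in> sets (distr M S X)" "B \<in> sets (distr M T Y)"
  then have [measurable]: "A \<in> sets S" "B \<in> sets T" by auto
  have "(\<lambda>\<omega>. (X \<omega>, Y \<omega>)) -` (A \<times> B) \<inter> space M = (X -` A \<inter> space M) \<inter> (Y -` B \<inter> space M)"
    by auto
  moreover have "prob ((X -` A \<inter> space M) \<inter> (Y -` B \<inter> space M)) = prob (X -` A \<inter> space M) * prob (Y -` B \<inter> space M)"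
    by (rule indep_setD[OF ind]) (auto intro: in_vimage_algebra)
  ultimately show "emeasure (distr M S X) A * emeasure (distr M T Y) B
      = emeasure (distr M (S \<Otimes>\<^sub>M T) (\<lambda>\<omega>. (X \<omega>, Y \<omega>))) (A \<times> B)"
    by (simp add: emeasure_distr emeasure_eq_measure ennreal_mult)
qed simp

text \<open>Both iterated integrals stay over M, so that the law of each variable can be inserted
  separately later.\<close>

lemma (in prob_space) nn_integral_indep_var:
  assumes ind: "indep_var S X T Y" and H[measurable]: "H \<in> borel_measurable (S \<Otimes>\<^sub>M T)"
  shows "(\<integral>\<^sup>+\<omega>. H (X \<omega>, Y \<omega>) \<partial>M) = (\<integral>\<^sup>+\<omega>. \<integral>\<^sup>+\<omega>'. H (X \<omega>, Y \<omega>') \<partial>M \<partial>M)"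
proof -
  have X[measurable]: "X \<in> measurable M S" and Y[measurable]: "Y \<in> measurable M T"
    and eq: "distr M S X \<Otimes>\<^sub>M distr M T Y = distr M (S \<Otimes>\<^sub>M T) (\<lambda>x. (X x, Y x))"
    using ind unfolding indep_var_distribution_eq by auto
  interpret D: prob_space "distr M T Y" by (rule prob_space_distr) fact
  have H': "H \<in> borel_measurable (S \<Otimes>\<^sub>M distr M T Y)"
    "H \<in> borel_measurable (distr M S X \<Otimes>\<^sub>M distr M T Y)"
    using H by (simp_all cong: measurable_cong_sets sets_pair_measure_cong)
  have "(\<integral>\<^sup>+\<omega>. H (X \<omega>, Y \<omega>) \<partial>M) = (\<integral>\<^sup>+z. H z \<partial>(distr M S X \<Otimes>\<^sub>M distr M T Y))"
    unfolding eq by (subst nn_integral_distr) auto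
  also have "\<dots> = (\<integral>\<^sup>+x. \<integral>\<^sup>+y. H (x, y) \<partial>distr M T Y \<partial>distr M S X)"
    by (rule D.nn_integral_fst[symmetric, OF H'(2)])
  also have "\<dots> = (\<integral>\<^sup>+\<omega>. \<integral>\<^sup>+y. H (X \<omega>, y) \<partial>distr M T Y \<partial>M)"
    by (rule nn_integral_distr[OF X]) (simp add: D.borel_measurable_nn_integral_fst[OF H'(1)])
  also have "\<dots> = (\<integral>\<^sup>+\<omega>. \<integral>\<^sup>+\<omega>'. H (X \<omega>, Y \<omega>') \<partial>M \<partial>M)"
  proof (intro nn_integral_cong, rule nn_integral_distr[OF Y])
    fix \<omega> assume "\<omega> \<in> space M"
    then have "X \<omega> \<in> space S" using X by (rule measurable_space[rotated])
    then have "(\<lambda>y. H (X \<omega>, y)) \<in> borel_measurable T" by measurable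
    then show "(\<lambda>y. H (X \<omega>, y)) \<in> borel_measurable (distr M T Y)" by simp
  qed
  finally show ?thesis .
qed

text \<open>The variables are split off one after the other. \<open>indep_var_restrict\<close>
  speaks of blocks of coordinates, so H reads off the entries of the blocks {i} and {j, k}, then of
  {j} and {k}.\<close>

lemma (in prob_space) nn_integral_indep_vars3:
  fixes X :: "'i \<Rightarrow> 'a \<Rightarrow> real"
  assumes ind: "indep_vars (\<lambda>_. borel) X I"
    and ijk: "i \<in> I" "j \<in> I" "k \<in> I" "i \<noteq> j" "i \<noteq> k" "j \<noteq> k"
    and [measurable]: "H \<in> borel_measurable (borel \<Otimes>\<^sub>M borel \<Otimes>\<^sub>M borel)"
  shows "(\<integral>\<^sup>+\<omega>. H (X i \<omega>, X j \<omega>, X k \<omega>) \<partial>M)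
    = (\<integral>\<^sup>+\<omega>. \<integral>\<^sup>+\<omega>'. \<integral>\<^sup>+\<omega>''. H (X i \<omega>, X j \<omega>', X k \<omega>'') \<partial>M \<partial>M \<partial>M)"
proof -
  let ?r = "\<lambda>J \<omega>. restrict (\<lambda>i. X i \<omega>) J"
  have 1: "indep_var (PiM {i} (\<lambda>_. borel)) (?r {i}) (PiM {j, k} (\<lambda>_. borel)) (?r {j, k})"
    using ijk by (intro indep_var_restrict[OF ind]) auto
  have 2: "indep_var (PiM {j} (\<lambda>_. borel)) (?r {j}) (PiM {k} (\<lambda>_. borel)) (?r {k})"
    using ijk by (intro indep_var_restrict[OF ind]) auto
  have "(\<integral>\<^sup>+\<omega>. H (X i \<omega>, X j \<omega>, X k \<omega>) \<partial>M) = (\<integral>\<^sup>+\<omega>. \<integral>\<^sup>+\<omega>'. H (X i \<omega>, X j \<omega>', X k \<omega>') \<partial>M \<partial>M)"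
    using nn_integral_indep_var[OF 1, of "\<lambda>x. H (fst x i, snd x j, snd x k)"] by simp
  moreover have "(\<integral>\<^sup>+\<omega>'. H (x, X j \<omega>', X k \<omega>') \<partial>M) = (\<integral>\<^sup>+\<omega>'. \<integral>\<^sup>+\<omega>''. H (x, X j \<omega>', X k \<omega>'') \<partial>M \<partial>M)" for x
    using nn_integral_indep_var[OF 2, of "\<lambda>y. H (x, fst y j, snd y k)"] by simp
  ultimately show ?thesis by simp
qed

text \<open>The values a v may coincide, so the integral is first summed over the distinct values
  and then regrouped by index. No other value matters, since the masses add up to 1.\<close>

lemma (in prob_space) nn_integral_discrete:
  assumes [measurable]: "X \<in> borel_measurable M" "h \<in> borel_measurable borel"
    and V: "finite V" "\<And>v. v \<in> V \<Longrightarrow> 0 \<le> b v" "(\<Sum>v\<in>V. b v) = 1"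
    and law: "\<And>x::real. prob {\<omega>\<in>space M. X \<omega> = x} = (\<Sum>v | v \<in> V \<and> a v = x. b v)"
  shows "(\<integral>\<^sup>+\<omega>. h (X \<omega>) \<partial>M) = (\<Sum>v\<in>V. ennreal (b v) * h (a v))"
proof -
  let ?E = "\<lambda>x. {\<omega>\<in>space M. X \<omega> = x}"
  have "prob (\<Union>x\<in>a ` V. ?E x) = (\<Sum>x\<in>a ` V. prob (?E x))"
    using V by (intro finite_measure_finite_Union) (auto simp: disjoint_family_on_def)
  also have "\<dots> = 1"
    using V unfolding law by (subst sum.image_gen[OF V(1), where g=a, symmetric]) auto
  finally have "AE \<omega> in M. \<omega> \<in> (\<Union>x\<in>a ` V. ?E x)"
    by (rule AE_prob_1)
  then have "(\<integral>\<^sup>+\<omega>. h (X \<omega>) \<partial>M) = (\<integral>\<^sup>+\<omega>. (\<Sum>x\<in>a ` V. h x * indicator (?E x) \<omega>) \<partial>M)"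
  proof (intro nn_integral_cong_AE, eventually_elim)
    case (elim \<omega>)
    then have "(\<Sum>x\<in>a ` V. h x * indicator (?E x) \<omega>) = (\<Sum>x\<in>a ` V. if x = X \<omega> then h (X \<omega>) else 0)"
      by (intro sum.cong) (auto simp: indicator_def)
    then show ?case
      using elim V by auto
  qed
  also have "\<dots> = (\<Sum>x\<in>a ` V. h x * emeasure M (?E x))"
    by (subst nn_integral_sum) (auto simp: nn_integral_cmult)
  also have "\<dots> = (\<Sum>x\<in>a ` V. \<Sum>v | v \<in> V \<and> a v = x. ennreal (b v) * h (a v))"
  proof (intro sum.cong refl)
    fix x
    have "emeasure M (?E x) = (\<Sum>v | v \<in> V \<and> a v = x. ennreal (b v))"
      unfolding emeasure_eq_measure law using V by (subst sum_ennreal) auto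
    then show "h x * emeasure M (?E x) = (\<Sum>v | v \<in> V \<and> a v = x. ennreal (b v) * h (a v))"
      by (auto simp: sum_distrib_left mult.commute intro!: sum.cong)
  qed
  also have "\<dots> = (\<Sum>v\<in>V. ennreal (b v) * h (a v))"
    by (rule sum.image_gen[OF V(1), symmetric])
  finally show ?thesis .
qed

section \<open>Averages of finite products in the interference field\<close>

context interference_field
begin

abbreviation "LM \<equiv> location_mark_algebra M u P G g"

lemma u_measurable [measurable]: "u z \<in> borel_measurable M"
  using ppp by (auto simp: homogeneous_ppp_def)

lemma mark_measurable [measurable]: "mark P G g i \<in> borel_measurable M"
  using marks_indep by (auto simp: indep_vars_def)

lemma mark_simps [simp]:
  "mark P G g (Inl z) = P z" "mark P G g (Inr (Inl z)) = G z" "mark P G g (Inr (Inr z)) = g z"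
  by (auto simp: mark_def)

lemma PGg_measurable [measurable]:
  "P z \<in> borel_measurable M" "G z \<in> borel_measurable M" "g z \<in> borel_measurable M"
  using mark_measurable[of "Inl z"] mark_measurable[of "Inr (Inl z)"] mark_measurable[of "Inr (Inr z)"]
  by simp_all

lemma locations_measurable [measurable]: "locations u \<in> measurable M (\<Pi>\<^sub>M z\<in>UNIV. borel)"
  unfolding locations_def by (intro measurable_PiM_single') auto

lemma marks_measurable [measurable]: "marks P G g \<in> measurable M (\<Pi>\<^sub>M i\<in>UNIV. borel)"
  unfolding marks_def by (intro measurable_PiM_single') auto

lemma LM_subalgebra: "subalgebra M LM"
  unfolding subalgebra_def location_mark_algebra_def
proof
  show "sets (vimage_algebra (space M) (\<lambda>\<omega>. (locations u \<omega>, marks P G g \<omega>))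
      (Pi\<^sub>M UNIV (\<lambda>z. borel) \<Otimes>\<^sub>M Pi\<^sub>M UNIV (\<lambda>i. borel))) \<subseteq> sets M"
    by (subst sets_vimage_algebra2) (auto simp: space_pair_measure space_PiM intro!: measurable_sets)
qed simp

lemma locations_marks_LM:
  "(\<lambda>\<omega>. (locations u \<omega>, marks P G g \<omega>)) \<in> measurable LM ((\<Pi>\<^sub>M z\<in>UNIV. borel) \<Otimes>\<^sub>M (\<Pi>\<^sub>M i\<in>UNIV. borel))"
  unfolding location_mark_algebra_def
  by (rule measurable_vimage_algebra1) (auto simp: space_pair_measure space_PiM)

lemma u_LM [measurable]: "u z \<in> borel_measurable LM"
  using measurable_compose[OF measurable_compose[OF locations_marks_LM measurable_fst]
      measurable_component_singleton[of z]]
  by (simp add: locations_def)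

lemma mark_LM: "mark P G g i \<in> borel_measurable LM"
  using measurable_compose[OF measurable_compose[OF locations_marks_LM measurable_snd]
      measurable_component_singleton[of i]]
  by (simp add: marks_def)

lemma PGg_LM [measurable]:
  "P z \<in> borel_measurable LM" "G z \<in> borel_measurable LM" "g z \<in> borel_measurable LM"
  using mark_LM[of "Inl z"] mark_LM[of "Inr (Inl z)"] mark_LM[of "Inr (Inr z)"]
  by simp_all

lemmas [measurable] = los_measurable

text \<open>The law of the LOS indicators is given for finite sets $J$ of interferers that are all LOS, so the
  product is expanded over such $J$, which leaves coefficients $a_z - b_z$ of either sign.\<close>

lemma integral_los:
  assumes I: "finite I" and \<beta>: "0 \<le> blockage S"
    and a[measurable]: "\<And>z. a z \<in> borel_measurable LM" and b[measurable]: "\<And>z. b z \<in> borel_measurable LM"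
    and a01: "\<And>z \<omega>. 0 \<le> a z \<omega>" "\<And>z \<omega>. a z \<omega> \<le> 1"
    and b01: "\<And>z \<omega>. 0 \<le> b z \<omega>" "\<And>z \<omega>. b z \<omega> \<le> 1"
  shows "(\<integral>\<omega>. (\<Prod>z\<in>I. if los z \<omega> then a z \<omega> else b z \<omega>) \<partial>M)
    = (\<integral>\<omega>. (\<Prod>z\<in>I. exp (- blockage S * norm (u z \<omega>)) * a z \<omega>
        + (1 - exp (- blockage S * norm (u z \<omega>))) * b z \<omega>) \<partial>M)"
proof -
  interpret F: finite_measure_subalgebra M LM
    by unfold_locales (rule LM_subalgebra)
  \<comment> \<open>The coefficient belonging to J when the factors c (a - b) + b = c a + (1 - c) b
    are multiplied out.\<close>
  define X where "X J \<omega> = (\<Prod>z\<in>J. a z \<omega> - b z \<omega>) * (\<Prod>z\<in>I - J. b z \<omega>)" for J \<omega>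
  define l where "l z \<omega> = exp (- blockage S * norm (u z \<omega>))" for z \<omega>
  define L where "L J = {\<omega>\<in>space M. \<forall>z\<in>J. los z \<omega>}" for J
  have X_LM[measurable]: "X J \<in> borel_measurable LM" for J
    unfolding X_def by measurable
  have X_M[measurable]: "X J \<in> borel_measurable M" for J
    by (rule measurable_from_subalg[OF LM_subalgebra X_LM])
  have X_bd: "\<bar>X J \<omega>\<bar> \<le> 1" for J \<omega>
  proof -
    have "\<bar>a z \<omega> - b z \<omega>\<bar> \<le> 1" "\<bar>b z \<omega>\<bar> \<le> 1" for z
      using a01[of z \<omega>] b01[of z \<omega>] by auto
    then show ?thesis
      unfolding X_def abs_mult abs_prod
      by (intro mult_le_one prod_le_1 prod_nonneg) auto
  qed
  have l01: "0 \<le> l z \<omega>" "l z \<omega> \<le> 1" for z \<omega>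
    using \<beta> by (auto simp: l_def)
  have [measurable]: "l z \<in> borel_measurable M" for z
    unfolding l_def by measurable
  \<comment> \<open>Applied twice: with c the LOS indicator before conditioning, and with c the LOS
    probability after it.\<close>
  have expand: "(\<Prod>z\<in>I. c z * a z \<omega> + (1 - c z) * b z \<omega>) = (\<Sum>J\<in>Pow I. (\<Prod>z\<in>J. c z) * X J \<omega>)" for c \<omega>
  proof -
    have "(\<Prod>z\<in>I. c z * a z \<omega> + (1 - c z) * b z \<omega>) = (\<Prod>z\<in>I. c z * (a z \<omega> - b z \<omega>) + b z \<omega>)"
      by (simp add: algebra_simps)
    then show ?thesis
      using I by (simp add: prod_add prod.distrib X_def mult_ac)
  qed
  have L_meas[measurable]: "L J \<in> sets M" if "J \<in> Pow I" for J
  proof -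
    have "countable J" using that I by (auto intro: countable_finite finite_subset)
    then show ?thesis unfolding L_def by measurable
  qed
  have "(\<integral>\<omega>. (\<Prod>z\<in>I. if los z \<omega> then a z \<omega> else b z \<omega>) \<partial>M)
      = (\<integral>\<omega>. (\<Sum>J\<in>Pow I. X J \<omega> * indicator (L J) \<omega>) \<partial>M)"
  proof (intro Bochner_Integration.integral_cong refl)
    fix \<omega> assume \<omega>: "\<omega> \<in> space M"
    have "(\<Prod>z\<in>I. if los z \<omega> then a z \<omega> else b z \<omega>)
        = (\<Prod>z\<in>I. (if los z \<omega> then 1 else 0) * a z \<omega> + (1 - (if los z \<omega> then 1 else 0)) * b z \<omega>)"
      by (intro prod.cong) auto
    also have "\<dots> = (\<Sum>J\<in>Pow I. (\<Prod>z\<in>J. if los z \<omega> then 1 else 0) * X J \<omega>)"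
      by (rule expand)
    also have "\<dots> = (\<Sum>J\<in>Pow I. X J \<omega> * indicator (L J) \<omega>)"
    proof (intro sum.cong refl)
      fix J assume "J \<in> Pow I"
      then have "finite J" using I by (auto intro: finite_subset)
      then have "(\<Prod>z\<in>J. if los z \<omega> then 1 else 0) = (indicator (L J) \<omega> :: real)"
        using \<omega> by (auto simp: L_def indicator_def prod_zero_iff)
      then show "(\<Prod>z\<in>J. if los z \<omega> then 1 else 0) * X J \<omega> = X J \<omega> * indicator (L J) \<omega>"
        by simp
    qed
    finally show "(\<Prod>z\<in>I. if los z \<omega> then a z \<omega> else b z \<omega>) = (\<Sum>J\<in>Pow I. X J \<omega> * indicator (L J) \<omega>)" .
  qed
  also have "\<dots> = (\<Sum>J\<in>Pow I. \<integral>\<omega>. X J \<omega> * indicator (L J) \<omega> \<partial>M)"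
  proof (intro Bochner_Integration.integral_sum)
    fix J assume "J \<in> Pow I"
    note L_meas[OF this, measurable]
    show "integrable M (\<lambda>\<omega>. X J \<omega> * indicator (L J) \<omega>)"
      using X_bd by (intro integrable_const_bound[where B=1] AE_I2) (auto simp: indicator_def)
  qed
  also have "\<dots> = (\<Sum>J\<in>Pow I. \<integral>\<omega>. (\<Prod>z\<in>J. l z \<omega>) * X J \<omega> \<partial>M)"
  proof (intro sum.cong refl)
    fix J assume J: "J \<in> Pow I"
    then have "finite J" using I by (auto intro: finite_subset)
    note L_meas[OF J, measurable]
    have "integrable M (\<lambda>\<omega>. X J \<omega> * indicator (L J) \<omega>)"
      using X_bd by (intro integrable_const_bound[where B=1] AE_I2) (auto simp: indicator_def)
    \<comment> \<open>\<open>X J\<close> is measurable for \<open>LM\<close>, so the event may be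
      replaced by its conditional probability, which \<open>los_law\<close> provides.\<close>
    then have "(\<integral>\<omega>. X J \<omega> * indicator (L J) \<omega> \<partial>M)
        = (\<integral>\<omega>. X J \<omega> * real_cond_exp M LM (indicator (L J)) \<omega> \<partial>M)"
      by (intro F.real_cond_exp_intg(2)[symmetric]) auto
    also have "\<dots> = (\<integral>\<omega>. (\<Prod>z\<in>J. l z \<omega>) * X J \<omega> \<partial>M)"
    proof (intro integral_cong_AE)
      show "AE \<omega> in M. X J \<omega> * real_cond_exp M LM (indicator (L J)) \<omega> = (\<Prod>z\<in>J. l z \<omega>) * X J \<omega>"
        using los_law[OF \<open>finite J\<close>] by eventually_elim (simp add: L_def l_def)
    qed measurable
    finally show "(\<integral>\<omega>. X J \<omega> * indicator (L J) \<omega> \<partial>M) = (\<integral>\<omega>. (\<Prod>z\<in>J. l z \<omega>) * X J \<omega> \<partial>M)" .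
  qed
  also have "\<dots> = (\<integral>\<omega>. (\<Sum>J\<in>Pow I. (\<Prod>z\<in>J. l z \<omega>) * X J \<omega>) \<partial>M)"
  proof (intro Bochner_Integration.integral_sum[symmetric] integrable_const_bound[where B=1] AE_I2)
    fix J \<omega>
    have "\<bar>\<Prod>z\<in>J. l z \<omega>\<bar> \<le> 1"
      using l01 unfolding abs_prod by (intro prod_le_1) auto
    then show "norm ((\<Prod>z\<in>J. l z \<omega>) * X J \<omega>) \<le> 1"
      using X_bd[of J \<omega>] unfolding real_norm_def abs_mult by (intro mult_le_one) auto
  qed measurable
  also have "\<dots> = (\<integral>\<omega>. (\<Prod>z\<in>I. l z \<omega> * a z \<omega> + (1 - l z \<omega>) * b z \<omega>) \<partial>M)"
    by (simp only: expand)
  finally show ?thesis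
    by (simp only: l_def)
qed

text \<open>Independence makes the joint law of locations and marks a product, so the locations can
  be frozen. The factors then depend on disjoint triples of marks, and their means multiply. That
  \<open>\<phi>\<close> carries no index z expresses that all interferers have the same mark
  law.\<close>

lemma integral_marks:
  fixes k :: "(real^2) \<times> real \<times> real \<times> real \<Rightarrow> real"
  assumes I: "finite I"
    and k[measurable]: "k \<in> borel_measurable (borel \<Otimes>\<^sub>M borel \<Otimes>\<^sub>M borel \<Otimes>\<^sub>M borel)"
    and k01: "\<And>x. 0 \<le> k x" "\<And>x. k x \<le> 1"
    and \<phi>: "\<And>z x. (\<integral>\<omega>. k (x, P z \<omega>, G z \<omega>, g z \<omega>) \<partial>M) = \<phi> x"
  shows "(\<integral>\<omega>. (\<Prod>z\<in>I. k (u z \<omega>, P z \<omega>, G z \<omega>, g z \<omega>)) \<partial>M) = (\<integral>\<omega>. (\<Prod>z\<in>I. \<phi> (u z \<omega>)) \<partial>M)"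
proof -
  let ?L = "\<Pi>\<^sub>M z\<in>(UNIV :: nat set). (borel :: (real^2) measure)"
  let ?K = "\<Pi>\<^sub>M i\<in>(UNIV :: (nat + nat + nat) set). (borel :: real measure)"
  define H where "H l m = (\<Prod>z\<in>I. k (l z, m (Inl z), m (Inr (Inl z)), m (Inr (Inr z))))"
    for l :: "nat \<Rightarrow> real^2" and m :: "nat + nat + nat \<Rightarrow> real"
  have H_meas[measurable]: "(\<lambda>(l, m). H l m) \<in> borel_measurable (?L \<Otimes>\<^sub>M ?K)"
    unfolding H_def by measurable
  have H01: "norm (H l m) \<le> 1" for l m
    unfolding H_def real_norm_def abs_prod using k01 by (intro prod_le_1) auto
  interpret L: prob_space "distr M ?L (locations u)" by (rule prob_space_distr) measurable
  interpret K: prob_space "distr M ?K (marks P G g)" by (rule prob_space_distr) measurable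
  interpret LK: pair_prob_space "distr M ?L (locations u)" "distr M ?K (marks P G g)" ..
  have joint: "distr M ?L (locations u) \<Otimes>\<^sub>M distr M ?K (marks P G g)
      = distr M (?L \<Otimes>\<^sub>M ?K) (\<lambda>\<omega>. (locations u \<omega>, marks P G g \<omega>))"
    by (intro distr_pair_indep_set locations_marks_indep) measurable
  have marginal: "(\<integral>\<omega>. H l (marks P G g \<omega>) \<partial>M) = (\<Prod>z\<in>I. \<phi> (l z))" for l
  proof -
    let ?C = "\<lambda>z. {Inl z, Inr (Inl z), Inr (Inr z)} :: (nat + nat + nat) set"
    have "indep_vars (\<lambda>z. PiM (?C z) (\<lambda>_. borel)) (\<lambda>z \<omega>. restrict (\<lambda>i. mark P G g i \<omega>) (?C z)) I"
      by (rule indep_vars_restrict[OF marks_indep]) (auto simp: disjoint_family_on_def)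
    then have "indep_vars (\<lambda>_. borel) (\<lambda>z \<omega>. (\<lambda>f. k (l z, f (Inl z), f (Inr (Inl z)), f (Inr (Inr z))))
        (restrict (\<lambda>i. mark P G g i \<omega>) (?C z))) I"
      by (rule indep_vars_compose2) measurable
    then have "indep_vars (\<lambda>_. borel) (\<lambda>z \<omega>. k (l z, P z \<omega>, G z \<omega>, g z \<omega>)) I"
      by simp
    then have "(\<integral>\<omega>. (\<Prod>z\<in>I. k (l z, P z \<omega>, G z \<omega>, g z \<omega>)) \<partial>M)
        = (\<Prod>z\<in>I. \<integral>\<omega>. k (l z, P z \<omega>, G z \<omega>, g z \<omega>) \<partial>M)"
      using k01 I by (intro indep_vars_lebesgue_integral integrable_const_bound[where B=1] AE_I2) auto
    then show ?thesis
      by (simp add: H_def marks_def \<phi>)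
  qed
  \<comment> \<open>\<open>\<phi>\<close> is known only through its values; written as an integral
    with parameter x it is measurable.\<close>
  have \<phi>_meas[measurable]: "\<phi> \<in> borel_measurable borel"
    unfolding \<phi>[of _ 0, symmetric] by measurable
  have "(\<integral>\<omega>. (\<Prod>z\<in>I. k (u z \<omega>, P z \<omega>, G z \<omega>, g z \<omega>)) \<partial>M)
      = (\<integral>\<omega>. (\<lambda>(l, m). H l m) (locations u \<omega>, marks P G g \<omega>) \<partial>M)"
    by (simp add: H_def locations_def marks_def)
  also have "\<dots> = (\<integral>x. (\<lambda>(l, m). H l m) x \<partial>(distr M ?L (locations u) \<Otimes>\<^sub>M distr M ?K (marks P G g)))"
    unfolding joint by (subst integral_distr) auto
  also have "\<dots> = (\<integral>l. \<integral>m. H l m \<partial>distr M ?K (marks P G g) \<partial>distr M ?L (locations u))"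
  proof -
    have "(\<lambda>(l, m). H l m) \<in> borel_measurable (distr M ?L (locations u) \<Otimes>\<^sub>M distr M ?K (marks P G g))"
      using H_meas by (simp cong: measurable_cong_sets)
    then have "integrable (distr M ?L (locations u) \<Otimes>\<^sub>M distr M ?K (marks P G g)) (\<lambda>(l, m). H l m)"
      using H01 by (intro LK.P.integrable_const_bound[where B=1] AE_I2) (auto simp: split_beta)
    from LK.integral_fst'[OF this] show ?thesis by simp
  qed
  also have "\<dots> = (\<integral>l. (\<Prod>z\<in>I. \<phi> (l z)) \<partial>distr M ?L (locations u))"
  proof (intro Bochner_Integration.integral_cong refl)
    fix l
    have "H l \<in> borel_measurable ?K"
      unfolding H_def by measurable
    then show "(\<integral>m. H l m \<partial>distr M ?K (marks P G g)) = (\<Prod>z\<in>I. \<phi> (l z))"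
      unfolding marginal[symmetric] by (intro integral_distr marks_measurable)
  qed
  also have "\<dots> = (\<integral>\<omega>. (\<Prod>z\<in>I. \<phi> (u z \<omega>)) \<partial>M)"
    by (subst integral_distr[OF locations_measurable]) (measurable, simp add: locations_def)
  finally show ?thesis .
qed

end

section \<open>The Laplace transform of the interference\<close>

text \<open>The maximum with 0 mirrors the truncation of negative summands by \<^const>\<open>ennreal\<close> in
  \<^const>\<open>interference\<close>.\<close>

definition damping :: "uplink \<Rightarrow> real \<Rightarrow> real \<Rightarrow> real \<Rightarrow> real \<times> real \<times> real \<Rightarrow> real" where
  "damping S s \<alpha> r = (\<lambda>(p, a, t).
     if p * r powr (- \<alpha>) < cutoff S then exp (- (s * max 0 (p * a * t * r powr (- \<alpha>)))) else 1)"

text \<open>The mean of 1 - \<open>damping\<close> over the marks of one interferer at distance r,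
  already evaluated over gain and fading. The loss is averaged because 1 - \<phi> is what enters the
  exponent of the Laplace functional.\<close>

definition damping_loss :: "uplink \<Rightarrow> real \<Rightarrow> real \<Rightarrow> real \<Rightarrow> ennreal" where
  "damping_loss S s \<alpha> r = (\<Sum>v = 1..4. ennreal (gain_prob S v) *
     (\<integral>\<^sup>+p. ennreal (power_density S p) * (indicator {p. p * r powr (- \<alpha>) < cutoff S} p *
        ennreal (fading_F (shape S) (s * gain_val S v * p * r powr (- \<alpha>) / real (shape S)))) \<partial>lborel))"

lemma damping_bounds: "0 \<le> s \<Longrightarrow> 0 \<le> damping S s \<alpha> r m" "0 \<le> s \<Longrightarrow> damping S s \<alpha> r m \<le> 1"
  by (auto simp: damping_def split_beta)

lemma power_density_outside: "p \<notin> {0..max_power S} \<Longrightarrow> power_density S p = 0"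
  unfolding power_density_def by (rule if_not_P)

lemma exp_neg_damping:
  assumes "0 \<le> s"
  shows "exp_neg (ennreal s * (if p * r powr (- \<alpha>) < cutoff S then ennreal (p * a * t * r powr (- \<alpha>)) else 0))
    = damping S s \<alpha> r (p, a, t)"
proof -
  have "ennreal s * ennreal x = ennreal (s * max 0 x)" for x
    using assms by (simp add: ennreal_mult)
  then show ?thesis
    using assms by (auto simp: damping_def exp_neg_ennreal)
qed

text \<open>An interferer is either LOS or NLOS, so it contributes to at most one of the two sums;
  the finite products are \<open>exp_neg\<close> of the partial sums of the merged series.\<close>

lemma tendsto_prod_damping:
  assumes s: "0 \<le> s"
  shows "(\<lambda>n. \<Prod>z<n. if los z \<omega> then damping S s (alpha_L S) (norm (u z \<omega>)) (P z \<omega>, G z \<omega>, g z \<omega>)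
        else damping S s (alpha_N S) (norm (u z \<omega>)) (P z \<omega>, G z \<omega>, g z \<omega>))
    \<longlonglongrightarrow> exp_neg (ennreal s * (interference S (alpha_L S) u P G g los \<omega>
          + interference S (alpha_N S) u P G g (\<lambda>z \<omega>. \<not> los z \<omega>) \<omega>))"
proof -
  define c where "c \<alpha> A z = (if A \<and> P z \<omega> * norm (u z \<omega>) powr (- \<alpha>) < cutoff S
           then ennreal (P z \<omega> * G z \<omega> * g z \<omega> * norm (u z \<omega>) powr (- \<alpha>)) else 0)" for \<alpha> A z
  define d where "d z = ennreal s * (c (alpha_L S) (los z \<omega>) z + c (alpha_N S) (\<not> los z \<omega>) z)" for z
  have "ennreal s * (interference S (alpha_L S) u P G g los \<omega>
          + interference S (alpha_N S) u P G g (\<lambda>z \<omega>. \<not> los z \<omega>) \<omega>) = (\<Sum>z. d z)"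
    unfolding interference_def d_def c_def
    by (subst suminf_add[OF summableI summableI]) (simp add: ennreal_suminf_cmult)
  moreover have "(\<lambda>n. exp_neg (\<Sum>z<n. d z)) \<longlonglongrightarrow> exp_neg (\<Sum>z. d z)"
    by (intro tendsto_exp_neg summable_LIMSEQ summableI)
  moreover have "exp_neg (d z) = (if los z \<omega> then damping S s (alpha_L S) (norm (u z \<omega>)) (P z \<omega>, G z \<omega>, g z \<omega>)
        else damping S s (alpha_N S) (norm (u z \<omega>)) (P z \<omega>, G z \<omega>, g z \<omega>))" for z
    using s by (simp add: d_def c_def exp_neg_damping)
  ultimately show ?thesis
    by (simp add: exp_neg_sum)
qed

lemma sum_1_4: "(\<Sum>v = 1..4. f v) = f 1 + f 2 + f 3 + (f (4::nat) :: 'b::comm_monoid_add)"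
proof -
  have "{1..4::nat} = {1, 2, 3, 4}" by auto
  then show ?thesis by (simp add: add_ac)
qed

lemma gain_prob_sum: "(\<Sum>v = 1..4. gain_prob S v) = 1"
  unfolding sum_1_4 gain_prob_def by (simp add: field_simps power2_eq_square)

section \<open>Interference under the sign conditions on the parameters\<close>

locale uplink_interference = interference_field +
  assumes shape: "shape S \<ge> 1"
    and pos: "bs_density S > 0" "blockage S > 0" "cutoff S > 0" "alpha_L S > 0" "alpha_N S > 0"
    and gains: "Gu_max S > 0" "Gu_min S > 0" "Gb_max S > 0" "Gb_min S > 0"
    and beams: "zeta_t S \<in> {0<..2 * pi}" "zeta_r S \<in> {0<..2 * pi}"
begin

lemma gain_val_pos: "0 < gain_val S v"
  using gains by (simp add: gain_val_def)

lemma gain_prob_nonneg: "0 \<le> gain_prob S v"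
  using beams by (auto simp: gain_prob_def)

text \<open>Measurability of the density is part of \<open>distributed\<close>; this bypasses the
  integral \<open>power_cumrate\<close> in its formula.\<close>

lemma power_density_measurable [measurable]: "(\<lambda>p. ennreal (power_density S p)) \<in> borel_measurable borel"
  using distributed_borel_measurable[OF power_law[of 0]] by simp

text \<open>The independent marks are averaged from the inside out: the fading yields
  \<open>fading_F\<close>, the gain a finite sum, the power an integral against its density.\<close>

lemma nn_integral_damping:
  assumes s: "0 < s"
  shows "(\<integral>\<^sup>+\<omega>. ennreal (1 - damping S s \<alpha> r (P z \<omega>, G z \<omega>, g z \<omega>)) \<partial>M) = damping_loss S s \<alpha> r"
proof -
  have [measurable]: "damping S s \<alpha> r \<in> borel_measurable (borel \<Otimes>\<^sub>M borel \<Otimes>\<^sub>M borel)"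
    unfolding damping_def split_beta by measurable
  define H where "H m = ennreal (1 - damping S s \<alpha> r m)" for m
  have H[measurable]: "H \<in> borel_measurable (borel \<Otimes>\<^sub>M borel \<Otimes>\<^sub>M borel)"
    unfolding H_def by measurable
  define R where "R v p = indicator {p. p * r powr (- \<alpha>) < cutoff S} p *
      ennreal (fading_F (shape S) (s * gain_val S v * p * r powr (- \<alpha>) / real (shape S)))" for v p
  have [measurable]: "R v \<in> borel_measurable borel" for v
    unfolding R_def by measurable
  \<comment> \<open>For p \<ge> 0 the nonnegative coefficient can be pulled out of the maximum,
    leaving the truncated fading. Negative p carry no density and drop out below.\<close>
  have fade: "(\<integral>\<^sup>+\<omega>. H (p, gain_val S v, g z \<omega>) \<partial>M) = R v p" if p: "0 \<le> p" for p v
  proof (cases "p * r powr (- \<alpha>) < cutoff S")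
    case True
    define t where "t = s * gain_val S v * p * r powr (- \<alpha>)"
    have t: "0 \<le> t"
      using s gain_val_pos[of v] p by (simp add: t_def)
    have max: "s * max 0 (p * gain_val S v * x * r powr (- \<alpha>)) = t * max 0 x" for x
    proof -
      have "max 0 (p * gain_val S v * r powr (- \<alpha>) * x) = p * gain_val S v * r powr (- \<alpha>) * max 0 x"
        using p gain_val_pos[of v] by (simp add: max_mult_distrib_left)
      then show ?thesis by (simp add: t_def mult_ac)
    qed
    have "(\<integral>\<^sup>+\<omega>. H (p, gain_val S v, g z \<omega>) \<partial>M)
        = (\<integral>\<^sup>+x. ennreal (erlang_density (shape S - 1) (real (shape S)) x) * H (p, gain_val S v, x) \<partial>lborel)"
      by (rule distributed_nn_integral[OF fading_law, symmetric]) measurable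
    also have "\<dots> = (\<integral>\<^sup>+x. ennreal (erlang_density (shape S - 1) (real (shape S)) x) * ennreal (1 - exp (- (t * max 0 x))) \<partial>lborel)"
      using True by (simp add: H_def damping_def max)
    also have "\<dots> = ennreal (fading_F (shape S) (t / real (shape S)))"
      by (rule nn_integral_fading[OF shape t])
    finally show ?thesis
      using True by (simp add: R_def t_def)
  qed (simp add: H_def damping_def R_def)
  have "(\<integral>\<^sup>+\<omega>. H (P z \<omega>, G z \<omega>, g z \<omega>) \<partial>M)
      = (\<integral>\<^sup>+\<omega>. \<integral>\<^sup>+\<omega>'. \<integral>\<^sup>+\<omega>''. H (P z \<omega>, G z \<omega>', g z \<omega>'') \<partial>M \<partial>M \<partial>M)"
    using nn_integral_indep_vars3[OF marks_indep, of "Inl z" "Inr (Inl z)" "Inr (Inr z)" H] by simp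
  also have "\<dots> = (\<integral>\<^sup>+\<omega>. (\<Sum>v = 1..4. ennreal (gain_prob S v) * (\<integral>\<^sup>+\<omega>''. H (P z \<omega>, gain_val S v, g z \<omega>'') \<partial>M)) \<partial>M)"
  proof (intro nn_integral_cong nn_integral_discrete)
    fix \<omega>
    show "(\<lambda>a. \<integral>\<^sup>+\<omega>''. H (P z \<omega>, a, g z \<omega>'') \<partial>M) \<in> borel_measurable borel"
      by measurable
  qed (auto intro: gain_prob_nonneg simp: gain_prob_sum[simplified] gain_law)
  also have "\<dots> = (\<integral>\<^sup>+p. ennreal (power_density S p) * (\<Sum>v = 1..4. ennreal (gain_prob S v) * (\<integral>\<^sup>+\<omega>''. H (p, gain_val S v, g z \<omega>'') \<partial>M)) \<partial>lborel)"
    by (rule distributed_nn_integral[OF power_law, symmetric]) measurable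
  also have "\<dots> = (\<integral>\<^sup>+p. (\<Sum>v = 1..4. ennreal (gain_prob S v) * (ennreal (power_density S p) * R v p)) \<partial>lborel)"
  proof (intro nn_integral_cong)
    fix p
    show "ennreal (power_density S p) * (\<Sum>v = 1..4. ennreal (gain_prob S v) * (\<integral>\<^sup>+\<omega>''. H (p, gain_val S v, g z \<omega>'') \<partial>M))
      = (\<Sum>v = 1..4. ennreal (gain_prob S v) * (ennreal (power_density S p) * R v p))"
    proof (cases "0 \<le> p")
      case True
      then show ?thesis
        by (simp add: fade sum_distrib_left ac_simps)
    qed (simp add: power_density_def)
  qed
  also have "\<dots> = damping_loss S s \<alpha> r"
    unfolding damping_loss_def by (subst nn_integral_sum) (auto simp: nn_integral_cmult R_def[symmetric])
  finally show ?thesis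
    by (simp add: H_def)
qed

lemma damping_loss_measurable [measurable]: "damping_loss S s \<alpha> \<in> borel_measurable borel"
  unfolding damping_loss_def indicator_def by measurable

text \<open>One computation for Q_n and V_n: w is the probability of LOS in the first case and of
  NLOS in the second, as a function of distance. For s = n \<eta> \<theta> / (\<rho>_o \<G>) the
  product \<open>s * gain_val S v\<close> is q_v.\<close>

lemma nn_integral_damping_loss:
  assumes s: "0 < s" and \<alpha>: "0 < \<alpha>"
    and [measurable]: "w \<in> borel_measurable borel" and w: "\<And>r. 0 \<le> r \<Longrightarrow> 0 \<le> w r"
  shows "ennreal (bs_density S) * (\<integral>\<^sup>+x. ennreal (w (norm (x::real^2))) * damping_loss S s \<alpha> (norm x) \<partial>lborel)
    = ennreal (2 * pi * bs_density S) *
     (\<Sum>v = 1..4. ennreal (gain_prob S v * (s * gain_val S v) powr (2 / \<alpha>)) *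
        (\<integral>\<^sup>+y\<in>{(cutoff S * (s * gain_val S v)) powr (- 1 / \<alpha>)..}. (\<integral>\<^sup>+p\<in>{0..max_power S}.
           ennreal (fading_F (shape S) (y powr (- \<alpha>) / real (shape S))
             * w ((s * gain_val S v * p) powr (1 / \<alpha>) * y) * y * p powr (2 / \<alpha>) * power_density S p) \<partial>lborel) \<partial>lborel))"
proof -
  define L where "L v x = ennreal (w (norm (x::real^2))) * (\<integral>\<^sup>+p. ennreal (power_density S p) * (indicator {p. p * norm x powr (- \<alpha>) < cutoff S} p *
        ennreal (fading_F (shape S) (s * gain_val S v * p * norm x powr (- \<alpha>) / real (shape S)))) \<partial>lborel)" for v x
  define J where "J v = (\<integral>\<^sup>+y\<in>{(cutoff S * (s * gain_val S v)) powr (- 1 / \<alpha>)..}. (\<integral>\<^sup>+p\<in>{0..max_power S}.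
           ennreal (fading_F (shape S) (y powr (- \<alpha>) / real (shape S))
             * w ((s * gain_val S v * p) powr (1 / \<alpha>) * y) * y * p powr (2 / \<alpha>) * power_density S p) \<partial>lborel) \<partial>lborel)" for v
  have [measurable]: "L v \<in> borel_measurable lborel" for v
    unfolding L_def indicator_def by measurable
  have L: "(\<integral>\<^sup>+x. L v x \<partial>lborel) = ennreal (2 * pi * (s * gain_val S v) powr (2 / \<alpha>)) * J v" for v
  proof -
    have q: "0 < s * gain_val S v"
      using s gain_val_pos by simp
    show ?thesis
      unfolding L_def J_def
      by (rule nn_integral_planar_interference[OF q \<alpha> pos(3) assms(3)])
         (erule w, rule power_density_measurable, erule power_density_outside)
  qed
  have "(\<integral>\<^sup>+x. ennreal (w (norm (x::real^2))) * damping_loss S s \<alpha> (norm x) \<partial>lborel)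
      = (\<integral>\<^sup>+x. (\<Sum>v = 1..4. ennreal (gain_prob S v) * L v x) \<partial>lborel)"
    unfolding damping_loss_def L_def by (simp add: sum_distrib_left mult.left_commute)
  also have "\<dots> = (\<Sum>v = 1..4. ennreal (gain_prob S v) * (ennreal (2 * pi * (s * gain_val S v) powr (2 / \<alpha>)) * J v))"
    by (subst nn_integral_sum) (auto simp: nn_integral_cmult L)
  finally have eq: "(\<integral>\<^sup>+x. ennreal (w (norm (x::real^2))) * damping_loss S s \<alpha> (norm x) \<partial>lborel)
    = (\<Sum>v = 1..4. ennreal (gain_prob S v) * (ennreal (2 * pi * (s * gain_val S v) powr (2 / \<alpha>)) * J v))" .
  have "ennreal (bs_density S) * (ennreal (gain_prob S v) * (ennreal (2 * pi * (s * gain_val S v) powr (2 / \<alpha>)) * J v))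
      = ennreal (2 * pi * bs_density S) * (ennreal (gain_prob S v * (s * gain_val S v) powr (2 / \<alpha>)) * J v)" for v
  proof -
    define c where "c = (s * gain_val S v) powr (2 / \<alpha>)"
    have c: "0 \<le> c" by (simp add: c_def)
    have "ennreal (bs_density S) * (ennreal (gain_prob S v) * ennreal (2 * pi * c))
        = ennreal (2 * pi * bs_density S) * ennreal (gain_prob S v * c)"
      using pos(1) gain_prob_nonneg[of v] by (simp only: ennreal_mult'[symmetric] less_imp_le mult_nonneg_nonneg pi_ge_zero zero_le_numeral) (simp add: mult_ac)
    then show ?thesis
      unfolding c_def[symmetric] by (simp only: mult.assoc[symmetric])
  qed
  then show ?thesis
    unfolding eq J_def[symmetric] by (simp add: sum_distrib_left)
qed

lemma laplace_interference:
  assumes s: "0 < s"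
  shows "(\<integral>\<omega>. exp_neg (ennreal s * (interference S (alpha_L S) u P G g los \<omega>
          + interference S (alpha_N S) u P G g (\<lambda>z \<omega>. \<not> los z \<omega>) \<omega>)) \<partial>M)
    = exp_neg (ennreal (bs_density S) *
        (\<integral>\<^sup>+x. ennreal (exp (- blockage S * norm (x::real^2))) * damping_loss S s (alpha_L S) (norm x) \<partial>lborel)
      + ennreal (bs_density S) *
        (\<integral>\<^sup>+x. ennreal (1 - exp (- blockage S * norm (x::real^2))) * damping_loss S s (alpha_N S) (norm x) \<partial>lborel))"
proof -
  define l where "l x = exp (- blockage S * norm (x::real^2))" for x
  have l01: "0 \<le> l x" "l x \<le> 1" for x
    using pos by (auto simp: l_def)
  have [measurable]: "l \<in> borel_measurable borel"
    unfolding l_def by measurable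
  \<comment> \<open>The mean factor of an interferer with location x and marks m, after averaging
    over its LOS indicator.\<close>
  define k where "k = (\<lambda>(x, m). l x * damping S s (alpha_L S) (norm x) m
      + (1 - l x) * damping S s (alpha_N S) (norm x) m)"
  have k[measurable]: "k \<in> borel_measurable (borel \<Otimes>\<^sub>M borel \<Otimes>\<^sub>M borel \<Otimes>\<^sub>M borel)"
    unfolding k_def damping_def split_beta by measurable
  have k01: "0 \<le> k x" "k x \<le> 1" for x
  proof -
    show "0 \<le> k x"
      using s l01 by (auto simp: k_def split_beta intro!: add_nonneg_nonneg mult_nonneg_nonneg damping_bounds)
    have "k x \<le> l (fst x) * 1 + (1 - l (fst x)) * 1"
      using s l01 unfolding k_def split_beta by (intro add_mono mult_left_mono damping_bounds) auto
    then show "k x \<le> 1" by simp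
  qed
  \<comment> \<open>The mean loss at x. It comes first because it is a sum of nonnegative integrals;
    \<phi> is then recovered as 1 - \<Psi>.\<close>
  define \<Psi> where "\<Psi> x = ennreal (l x) * damping_loss S s (alpha_L S) (norm x)
      + ennreal (1 - l x) * damping_loss S s (alpha_N S) (norm x)" for x
  have \<Psi>_meas[measurable]: "\<Psi> \<in> borel_measurable borel"
    unfolding \<Psi>_def by measurable
  have \<Psi>: "(\<integral>\<^sup>+\<omega>. ennreal (1 - k (x, P z \<omega>, G z \<omega>, g z \<omega>)) \<partial>M) = \<Psi> x" for x z
  proof -
    have [measurable]: "damping S s \<alpha> r \<in> borel_measurable (borel \<Otimes>\<^sub>M borel \<Otimes>\<^sub>M borel)" for \<alpha> r
      unfolding damping_def split_beta by measurable
    have "ennreal (1 - k (x, m)) = ennreal (l x) * ennreal (1 - damping S s (alpha_L S) (norm x) m)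
        + ennreal (1 - l x) * ennreal (1 - damping S s (alpha_N S) (norm x) m)" for m
    proof -
      have "ennreal (l x) * ennreal (1 - damping S s (alpha_L S) (norm x) m)
          + ennreal (1 - l x) * ennreal (1 - damping S s (alpha_N S) (norm x) m)
        = ennreal (l x * (1 - damping S s (alpha_L S) (norm x) m) + (1 - l x) * (1 - damping S s (alpha_N S) (norm x) m))"
        using l01[of x] damping_bounds[of s S _ "norm x" m] s
        by (subst ennreal_plus) (auto simp: ennreal_mult')
      then show ?thesis by (simp add: k_def algebra_simps)
    qed
    then show ?thesis
      by (simp add: nn_integral_add nn_integral_cmult nn_integral_damping[OF s] \<Psi>_def)
  qed
  define \<phi> where "\<phi> x = 1 - enn2real (\<Psi> x)" for x
  \<comment> \<open>Besides \<phi> \<ge> 0 this gives the finiteness that lets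
    \<open>enn2real\<close> be undone at the end.\<close>
  have \<Psi>_le: "\<Psi> x \<le> 1" for x
  proof -
    have "\<Psi> x \<le> (\<integral>\<^sup>+\<omega>. 1 \<partial>M)"
      unfolding \<Psi>[of x 0, symmetric] using k01 by (intro nn_integral_mono) auto
    then show ?thesis by (simp add: emeasure_space_1)
  qed
  have k_\<phi>: "(\<integral>\<omega>. k (x, P z \<omega>, G z \<omega>, g z \<omega>) \<partial>M) = \<phi> x" for x z
  proof -
    have int: "integrable M (\<lambda>\<omega>. k (x, P z \<omega>, G z \<omega>, g z \<omega>))"
      using k01 by (intro integrable_const_bound[where B=1] AE_I2) auto
    have "(\<integral>\<omega>. 1 - k (x, P z \<omega>, G z \<omega>, g z \<omega>) \<partial>M) = enn2real (\<Psi> x)"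
      unfolding \<Psi>[of x z, symmetric] using k01 by (intro integral_eq_nn_integral) auto
    then show ?thesis
      using int by (simp add: \<phi>_def prob_space)
  qed
  have \<phi>01: "0 \<le> \<phi> x" "\<phi> x \<le> 1" for x
  proof -
    have "enn2real (\<Psi> x) \<le> enn2real 1"
      using \<Psi>_le by (intro enn2real_mono) auto
    then show "0 \<le> \<phi> x" "\<phi> x \<le> 1" by (auto simp: \<phi>_def)
  qed
  have [measurable]: "\<phi> \<in> borel_measurable borel"
    unfolding \<phi>_def by measurable
  \<comment> \<open>Chosen so that \<open>exp_neg (f x)\<close> is \<phi> x, with infinity in place
    of -ln 0.\<close>
  define f where "f x = (if \<phi> x = 0 then \<top> else ennreal (- ln (\<phi> x)))" for x
  have f: "exp_neg (f x) = \<phi> x" for x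
    unfolding f_def using \<phi>01 by (rule exp_neg_minus_ln)
  have [measurable]: "f \<in> borel_measurable borel"
    unfolding f_def by measurable

  let ?I = "\<lambda>\<omega>. exp_neg (ennreal s * (interference S (alpha_L S) u P G g los \<omega>
          + interference S (alpha_N S) u P G g (\<lambda>z \<omega>. \<not> los z \<omega>) \<omega>))"
  let ?d = "\<lambda>\<alpha> z \<omega>. damping S s \<alpha> (norm (u z \<omega>)) (P z \<omega>, G z \<omega>, g z \<omega>)"
  have d_LM[measurable]: "?d \<alpha> z \<in> borel_measurable LM" for \<alpha> z
    unfolding damping_def split_beta by measurable
  have d_M[measurable]: "?d \<alpha> z \<in> borel_measurable M" for \<alpha> z
    by (rule measurable_from_subalg[OF LM_subalgebra d_LM])
  have I_meas[measurable]: "?I \<in> borel_measurable M"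
    unfolding interference_def by measurable
  have "(\<lambda>n. \<integral>\<omega>. (\<Prod>z<n. if los z \<omega> then ?d (alpha_L S) z \<omega> else ?d (alpha_N S) z \<omega>) \<partial>M) \<longlonglongrightarrow> (\<integral>\<omega>. ?I \<omega> \<partial>M)"
  proof (intro integral_dominated_convergence[where w="\<lambda>_. 1"] AE_I2 tendsto_prod_damping)
    show "norm (\<Prod>z<n. if los z \<omega> then ?d (alpha_L S) z \<omega> else ?d (alpha_N S) z \<omega>) \<le> 1" for n \<omega>
      unfolding real_norm_def abs_prod using s damping_bounds[of s] by (intro prod_le_1) auto
  qed (use s in auto)
  \<comment> \<open>For each n the two means agree exactly, so the two sequences have the same
    limit.\<close>
  moreover have "(\<integral>\<omega>. (\<Prod>z<n. if los z \<omega> then ?d (alpha_L S) z \<omega> else ?d (alpha_N S) z \<omega>) \<partial>M)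
      = (\<integral>\<omega>. exp_neg (\<Sum>z<n. f (u z \<omega>)) \<partial>M)" for n
  proof -
    have "(\<integral>\<omega>. (\<Prod>z<n. if los z \<omega> then ?d (alpha_L S) z \<omega> else ?d (alpha_N S) z \<omega>) \<partial>M)
        = (\<integral>\<omega>. (\<Prod>z<n. k (u z \<omega>, P z \<omega>, G z \<omega>, g z \<omega>)) \<partial>M)"
      unfolding k_def l_def prod.case using pos s
      by (intro integral_los damping_bounds d_LM) auto
    also have "\<dots> = (\<integral>\<omega>. (\<Prod>z<n. \<phi> (u z \<omega>)) \<partial>M)"
      by (intro integral_marks k k01 k_\<phi>) auto
    finally show ?thesis
      by (simp add: exp_neg_sum f)
  qed
  moreover have "(\<lambda>n. \<integral>\<omega>. exp_neg (\<Sum>z<n. f (u z \<omega>)) \<partial>M) \<longlonglongrightarrow> (\<integral>\<omega>. exp_neg (\<Sum>z. f (u z \<omega>)) \<partial>M)"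
    by (intro integral_dominated_convergence[where w="\<lambda>_. 1"] AE_I2 tendsto_exp_neg summable_LIMSEQ summableI) auto
  ultimately have "(\<integral>\<omega>. ?I \<omega> \<partial>M) = (\<integral>\<omega>. exp_neg (\<Sum>z. f (u z \<omega>)) \<partial>M)"
    by (simp add: LIMSEQ_unique)
  also have "\<dots> = exp_neg (ennreal (bs_density S) * (\<integral>\<^sup>+x. ennreal (1 - exp_neg (f x)) \<partial>lborel))"
    by (rule ppp_laplace[OF prob_space_axioms pos(1) ppp]) measurable
  also have "(\<lambda>x. ennreal (1 - exp_neg (f x))) = \<Psi>"
  proof
    fix x
    have "\<Psi> x < \<top>"
      using \<Psi>_le[of x] by (rule order.strict_trans1) simp
    then show "ennreal (1 - exp_neg (f x)) = \<Psi> x"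
      by (simp add: f \<phi>_def)
  qed
  also have "ennreal (bs_density S) * (\<integral>\<^sup>+x. \<Psi> x \<partial>lborel)
      = ennreal (bs_density S) * (\<integral>\<^sup>+x. ennreal (l x) * damping_loss S s (alpha_L S) (norm x) \<partial>lborel)
      + ennreal (bs_density S) * (\<integral>\<^sup>+x. ennreal (1 - l x) * damping_loss S s (alpha_N S) (norm x) \<partial>lborel)"
    unfolding \<Psi>_def by (subst nn_integral_add) (auto simp: distrib_left)
  finally show ?thesis
    by (simp only: l_def)
qed

end

section \<open>Binomial expansion of the outage probability\<close>

theorem theorem2:
  fixes M :: "'w measure" and S :: uplink
    and u :: "nat \<Rightarrow> 'w \<Rightarrow> real^2" and P G g :: "nat \<Rightarrow> 'w \<Rightarrow> real"
    and los :: "nat \<Rightarrow> 'w \<Rightarrow> bool" and \<theta> :: real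
  assumes "shape S \<ge> 1"
    and "bs_density S > 0" and "blockage S > 0" and "cutoff S > 0" and "max_power S > 0"
    and "alpha_L S > 0" and "alpha_N S > 0" and "\<theta> > 0" and "noise S \<ge> 0"
    and "Gu_max S > 0" and "Gu_min S > 0" and "Gb_max S > 0" and "Gb_min S > 0"
    and "zeta_t S \<in> {0<..2 * pi}" and "zeta_r S \<in> {0<..2 * pi}"
    and "interference_field M S u P G g los"
  shows "sinr_outage M S u P G g los \<theta> =
    1 - (\<Sum>n = 1..shape S. (- 1) ^ (n + 1) * real (shape S choose n) *
          exp_neg (ennreal (eta (shape S) * real n * \<theta> * noise S / (cutoff S * main_gain S))
                   + Q_term S \<theta> n + V_term S \<theta> n))"
proof -
  interpret interference_field M S u P G g los by fact
  interpret uplink_interference M S u P G g los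
    by unfold_locales (use assms in auto)
  let ?N = "shape S"
  define c where "c = eta ?N * \<theta> / (cutoff S * main_gain S)"
  have eta: "eta ?N > 0"
    using assms(1) by (simp add: eta_def)
  have main: "main_gain S > 0"
    using assms by (simp add: main_gain_def)
  have c: "0 < c"
    using assms eta main by (simp add: c_def)
  define I where "I \<omega> = interference S (alpha_L S) u P G g los \<omega>
      + interference S (alpha_N S) u P G g (\<lambda>z \<omega>. \<not> los z \<omega>) \<omega>" for \<omega>
  define X where "X \<omega> = ennreal c * (ennreal (noise S) + I \<omega>)" for \<omega>
  have I_meas[measurable]: "I \<in> borel_measurable M"
    unfolding I_def interference_def by measurable
  have [measurable]: "X \<in> borel_measurable M"
    unfolding X_def by measurable
  \<comment> \<open>The n-th power of exp (-X) scales the exponent by n, which gives the transform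
    at s = n c; the noise is constant and factors out.\<close>
  have moment: "(\<integral>\<omega>. exp_neg (X \<omega>) ^ n \<partial>M)
      = exp_neg (ennreal (eta ?N * real n * \<theta> * noise S / (cutoff S * main_gain S)) + Q_term S \<theta> n + V_term S \<theta> n)"
    if n: "1 \<le> n" for n
  proof -
    define s where "s = real n * c"
    have s: "0 < s" using n c by (simp add: s_def)
    have q: "s * gain_val S v = q_val S \<theta> n v" for v
      by (simp add: s_def c_def q_val_def)
    \<comment> \<open>\<rho>_o cancels in \<rho>_o q_v, which leaves the base of \<A> and
      \<B>.\<close>
    have lim: "(cutoff S * q_val S \<theta> n v) powr (- 1 / \<alpha>) = lower_limit S \<alpha> \<theta> n v" for v \<alpha>
      using assms(4) by (simp add: lower_limit_def q_val_def)
    have "ennreal (real n) * X \<omega> = ennreal (s * noise S) + ennreal s * I \<omega>" for \<omega>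
      using c assms(9) by (simp add: X_def s_def ennreal_mult distrib_left mult.assoc)
    then have "exp_neg (X \<omega>) ^ n = exp_neg (ennreal (s * noise S)) * exp_neg (ennreal s * I \<omega>)" for \<omega>
      by (simp only: exp_neg_of_nat_mult[symmetric] exp_neg_add)
    then have "(\<integral>\<omega>. exp_neg (X \<omega>) ^ n \<partial>M) = exp_neg (ennreal (s * noise S)) * (\<integral>\<omega>. exp_neg (ennreal s * I \<omega>) \<partial>M)"
      by simp
    also have "(\<integral>\<omega>. exp_neg (ennreal s * I \<omega>) \<partial>M) = exp_neg (Q_term S \<theta> n + V_term S \<theta> n)"
    proof -
      have Q: "ennreal (bs_density S) *
        (\<integral>\<^sup>+x. ennreal (exp (- blockage S * norm (x::real^2))) * damping_loss S s (alpha_L S) (norm x) \<partial>lborel) = Q_term S \<theta> n"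
        using nn_integral_damping_loss[OF s pos(4), of "\<lambda>r. exp (- blockage S * r)"] pos
        unfolding Q_term_def q lim mult.assoc by simp
      have V: "ennreal (bs_density S) *
        (\<integral>\<^sup>+x. ennreal (1 - exp (- blockage S * norm (x::real^2))) * damping_loss S s (alpha_N S) (norm x) \<partial>lborel) = V_term S \<theta> n"
        using nn_integral_damping_loss[OF s pos(5), of "\<lambda>r. 1 - exp (- blockage S * r)"] pos
        unfolding V_term_def q lim mult.assoc by simp
      show ?thesis
        unfolding I_def laplace_interference[OF s] Q V ..
    qed
    also have "exp_neg (ennreal (s * noise S)) * exp_neg (Q_term S \<theta> n + V_term S \<theta> n)
        = exp_neg (ennreal (s * noise S) + Q_term S \<theta> n + V_term S \<theta> n)"
      by (simp add: exp_neg_add mult.assoc)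
    also have "s * noise S = eta ?N * real n * \<theta> * noise S / (cutoff S * main_gain S)"
      by (simp add: s_def c_def)
    finally show ?thesis .
  qed
  have int: "integrable M (\<lambda>\<omega>. exp_neg (X \<omega>) ^ n)" for n
    by (intro integrable_const_bound[where B=1] AE_I2) (auto intro: power_le_one)
  have "sinr_outage M S u P G g los \<theta> = (\<integral>\<omega>. (1 - exp_neg (X \<omega>)) ^ ?N \<partial>M)"
    by (simp add: sinr_outage_def X_def I_def c_def add.assoc)
  also have "\<dots> = (\<integral>\<omega>. (\<Sum>n\<le>?N. ((- 1) ^ n * real (?N choose n)) * exp_neg (X \<omega>) ^ n) \<partial>M)"
  proof (intro Bochner_Integration.integral_cong refl)
    fix \<omega>
    have "(- exp_neg (X \<omega>) + 1) ^ ?N = (\<Sum>n\<le>?N. ((- 1) ^ n * real (?N choose n)) * exp_neg (X \<omega>) ^ n)"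
      unfolding binomial_ring by (intro sum.cong refl) (simp add: power_minus[of "exp_neg (X \<omega>)"])
    then show "(1 - exp_neg (X \<omega>)) ^ ?N = (\<Sum>n\<le>?N. ((- 1) ^ n * real (?N choose n)) * exp_neg (X \<omega>) ^ n)"
      by simp
  qed
  also have "\<dots> = (\<Sum>n\<le>?N. ((- 1) ^ n * real (?N choose n)) * (\<integral>\<omega>. exp_neg (X \<omega>) ^ n \<partial>M))"
    using int by (subst Bochner_Integration.integral_sum) auto
  \<comment> \<open>The term n = 0 is the total mass 1. The claim has the sign (-1)^(n+1) instead of
    (-1)^n, which is why it subtracts the sum.\<close>
  also have "\<dots> = 1 + (\<Sum>n = 1..?N. ((- 1) ^ n * real (?N choose n)) * (\<integral>\<omega>. exp_neg (X \<omega>) ^ n \<partial>M))"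
    by (simp add: atMost_atLeast0 sum.atLeast_Suc_atMost prob_space)
  also have "\<dots> = 1 + (\<Sum>n = 1..?N. ((- 1) ^ n * real (?N choose n)) *
      exp_neg (ennreal (eta ?N * real n * \<theta> * noise S / (cutoff S * main_gain S)) + Q_term S \<theta> n + V_term S \<theta> n))"
    using moment by simp
  finally show ?thesis
    by (simp add: sum_negf)
qed

end
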